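(* Let $L\ge 2$ and consider the subsystem toric code on the $L\times L$ periodic square lattice with $n=3L^2$ qubits, with triangle operators $G(T)$, stabilizers $S^X_p,S^Z_p$, and stabilizer group $\mathcal S$ as defined in the context. Then: (i) triangle operators belonging to different plaquettes commute, every triangle operator commutes with every $S^X_p$ and $S^Z_p$, and $\mathcal S$ is abelian; (ii) $\prod_p S^X_p=\prod_p S^Z_p=I$ are the only dependencies among the generators $S^X_p,S^Z_p$, so $\mathcal S$ has $2(L^2-1)$ independent generators and the codespace $\mathcal C=\{\psi: S^X_p\psi=S^Z_p\psi=\psi\ \forall p\}$ has dimension $2^{L^2+2}$; (iii) the $L^2+2$ encoded qubits split into $L^2$ gauge qubits, one per plaquette $p$, with logical Pauli operators $\overline X_p=G(T^{SW}_p)$, $\overline Z_p=G(T^{SE}_p)$, and $k=2$ logical qubits with logical Pauli operators $$\overline X_1=\prod_{j\in\Gamma}X_j,\quad \overline Z_1=\prod_{j\in\Lambda}Z_j,\quad \overline X_2=\prod_{j\in\Lambda}X_j,\quad \overline Z_2=\prod_{j\in\Gamma}Z_j,$$ which commute with all triangle operators and satisfy $\overline X_i\overline Z_j=(-1)^{\delta_{i,j}}\overline Z_j\overline X_i$ for $i,j\in\{1,2\}$, with $\overline{X}_1$ commuting with $\overline{X}_2$ and $\overline{Z}_1$ commuting with $\overline{Z}_2$; (iv) the minimum distance of this subsystem code is exactly $L$. Thus the code has parameters $[[3L^2,2,L]]$.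
   Context: Lattice: the square lattice of size $L\times L$ with periodic boundary conditions, having $L^2$ vertices, $2L^2$ edges and $L^2$ plaquettes. One qubit sits at every vertex and one at the centre of every edge. $X_j,Z_j$ denote Pauli operators on qubit $j$. Triangles: a triangle is a triple $T=(u,f,g)$ where $u$ is a vertex and $f,g$ are two orthogonal edges incident to $u$; it belongs to the plaquette having both $f$ and $g$ on its boundary. $T$ is called SW, SE, NW or NE if $u$ is the south-west, south-east, north-west or north-east corner of that plaquette. Write $T^{SW}_p$, etc., for the triangles of plaquette $p$. Triangle operators: $G(T)=X_uX_fX_g$ if $T$ is SW or NE, and $G(T)=Z_uZ_fZ_g$ if $T$ is SE or NW. Stabilizers: $S^X_p=G(T^{SW}_p)G(T^{NE}_p)$ and $S^Z_p=G(T^{SE}_p)G(T^{NW}_p)$ for each plaquette $p$; $\mathcal S$ is the group generated by all of them. $\Gamma$ (resp. $\Lambda$) is the set of the $2L$ qubits (vertices and edges) lying on a fixed horizontal (resp. vertical) line of the lattice. The minimum distance of the subsystem code is the minimum weight (number of qubits acted on non-trivially) of a Pauli operator $E$ that commutes with all stabilizers and acts non-trivially on the logical qubits, i.e. anti-commutes with at least one of $\overline X_1,\overline Z_1,\overline X_2,\overline Z_2$. *)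

theory Defs
  imports
    Complex_Main
    "HOL-Library.Function_Algebras"
    "HOL-Algebra.Generated_Groups"
begin

section \<open>Systems of qubits\<close>

text \<open>
  The qubits of a system are labelled by a finite set \<open>Q\<close>.  A computational basis vector is given
  by the set \<open>s \<subseteq> Q\<close> of qubits in state 1, and a vector of the Hilbert space by its amplitudes
  \<open>\<psi> s\<close>; amplitudes outside \<open>Pow Q\<close> are 0.  Operators are extended by 0 outside the Hilbert space:
  every operator below gives a result with amplitude 0 at each \<open>s\<close> not contained in \<open>Q\<close> and reads
  only the amplitudes at subsets of \<open>Q\<close>.  Hence equality of functions is the same as equality of
  operators on \<open>hilbert Q\<close>, and the identity operator is \<open>id_op Q\<close> rather than \<open>id\<close>.
\<close>

type_synonym 'q state = "'q set \<Rightarrow> complex"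
type_synonym 'q qop = "'q state \<Rightarrow> 'q state"

definition hilbert :: "'q set \<Rightarrow> 'q state set" where
  "hilbert Q = {\<psi>. \<forall>s. \<not> s \<subseteq> Q \<longrightarrow> \<psi> s = 0}"

definition scale_state :: "complex \<Rightarrow> 'q state \<Rightarrow> 'q state" where
  "scale_state c \<psi> = (\<lambda>s. c * \<psi> s)"

global_interpretation states: vector_space scale_state
  defines state_dim = states.dim
  by unfold_locales (auto simp: scale_state_def fun_eq_iff algebra_simps)

definition state_inner :: "'q set \<Rightarrow> 'q state \<Rightarrow> 'q state \<Rightarrow> complex" where
  "state_inner Q \<phi> \<psi> = (\<Sum>s\<in>Pow Q. cnj (\<phi> s) * \<psi> s)"

definition id_op :: "'q set \<Rightarrow> 'q qop" where
  "id_op Q \<psi> = (\<lambda>s. if s \<subseteq> Q then \<psi> s else 0)"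

definition pauli_X :: "'q set \<Rightarrow> 'q \<Rightarrow> 'q qop" where
  "pauli_X Q j \<psi> = (\<lambda>s. if s \<subseteq> Q then \<psi> (if j \<in> s then s - {j} else insert j s) else 0)"

definition pauli_Z :: "'q set \<Rightarrow> 'q \<Rightarrow> 'q qop" where
  "pauli_Z Q j \<psi> = (\<lambda>s. if s \<subseteq> Q then (if j \<in> s then - \<psi> s else \<psi> s) else 0)"

definition pauli_Y :: "'q set \<Rightarrow> 'q \<Rightarrow> 'q qop" where
  "pauli_Y Q j \<psi> = scale_state \<i> (pauli_X Q j (pauli_Z Q j \<psi>))"

definition commute :: "'q qop \<Rightarrow> 'q qop \<Rightarrow> bool" where
  "commute A B \<longleftrightarrow> A \<circ> B = B \<circ> A"

definition anticommute :: "'q qop \<Rightarrow> 'q qop \<Rightarrow> bool" where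
  "anticommute A B \<longleftrightarrow> A \<circ> B = (\<lambda>\<psi>. scale_state (-1) (B (A \<psi>)))"

text \<open>Product of a finite family of operators; only meaningful (independent of the order of the
  factors) if the members of the family commute pairwise, as they do wherever it is used.\<close>

definition op_prod :: "'q set \<Rightarrow> ('a \<Rightarrow> 'q qop) \<Rightarrow> 'a set \<Rightarrow> 'q qop" where
  "op_prod Q f A = Finite_Set.fold (\<lambda>a T. f a \<circ> T) (id_op Q) A"

datatype pauli = PI | PX | PY | PZ

fun pauli_at :: "'q set \<Rightarrow> pauli \<Rightarrow> 'q \<Rightarrow> 'q qop" where
  "pauli_at Q PI j = id_op Q"
| "pauli_at Q PX j = pauli_X Q j"
| "pauli_at Q PY j = pauli_Y Q j"
| "pauli_at Q PZ j = pauli_Z Q j"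

definition pauli_string :: "'q set \<Rightarrow> ('q \<Rightarrow> pauli) \<Rightarrow> 'q qop" where
  "pauli_string Q P = op_prod Q (\<lambda>j. pauli_at Q (P j) j) Q"

definition weight :: "'q set \<Rightarrow> ('q \<Rightarrow> pauli) \<Rightarrow> nat" where
  "weight Q P = card {j \<in> Q. P j \<noteq> PI}"

definition pauli_group :: "'q set \<Rightarrow> 'q qop monoid" where
  "pauli_group Q =
     \<lparr>carrier = {\<lambda>\<psi>. scale_state c (pauli_string Q P \<psi>) | c P. c \<in> {1, -1, \<i>, -\<i>}},
      monoid.mult = (\<circ>),
      one = id_op Q\<rparr>"


section \<open>Stabilizer subsystem codes\<close>

definition codespace :: "'q set \<Rightarrow> 'q qop set \<Rightarrow> 'q state set" where
  "codespace Q Ss = {\<psi> \<in> hilbert Q. \<forall>S\<in>Ss. S \<psi> = \<psi>}"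

definition independent_gens :: "('a, 'b) monoid_scheme \<Rightarrow> 'a set \<Rightarrow> bool" where
  "independent_gens G Gs \<longleftrightarrow> (\<forall>g\<in>Gs. g \<notin> generate G (Gs - {g}))"

text \<open>\<open>C\<close> is the state space of a system of qubits labelled by \<open>R\<close> on which \<open>X e\<close> and \<open>Z e\<close> act as
  the Pauli operators of qubit \<open>e\<close>: there is a unitary map from \<open>C\<close> onto \<open>hilbert R\<close> (the tensor
  product of one qubit for each \<open>e \<in> R\<close>) taking the former to the latter.\<close>

definition encodes ::
  "'q set \<Rightarrow> 'q state set \<Rightarrow> 'r set \<Rightarrow> ('r \<Rightarrow> 'q qop) \<Rightarrow> ('r \<Rightarrow> 'q qop) \<Rightarrow> bool" where
  "encodes Q C R X Z \<longleftrightarrow>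
     (\<exists>U :: 'q state \<Rightarrow> 'r state.
        bij_betw U C (hilbert R) \<and>
        (\<forall>\<phi>\<in>C. \<forall>\<psi>\<in>C. U (\<phi> + \<psi>) = U \<phi> + U \<psi>) \<and>
        (\<forall>a. \<forall>\<psi>\<in>C. U (scale_state a \<psi>) = scale_state a (U \<psi>)) \<and>
        (\<forall>\<phi>\<in>C. \<forall>\<psi>\<in>C. state_inner R (U \<phi>) (U \<psi>) = state_inner Q \<phi> \<psi>) \<and>
        (\<forall>e\<in>R. \<forall>\<psi>\<in>C.
           X e \<psi> \<in> C \<and> U (X e \<psi>) = pauli_X R e (U \<psi>) \<and>
           Z e \<psi> \<in> C \<and> U (Z e \<psi>) = pauli_Z R e (U \<psi>)))"

text \<open>\<open>Ss\<close> are the stabilizers and \<open>Ls\<close> the logical Pauli operators of the logical (not gauge)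
  qubits.  A scalar phase of a Pauli operator affects neither its weight nor which Pauli operators
  it commutes or anticommutes with, so it suffices to range over Pauli strings.
  Beware of \<open>Inf {} = 0\<close> on \<open>nat\<close>.\<close>

definition min_distance :: "'q set \<Rightarrow> 'q qop set \<Rightarrow> 'q qop set \<Rightarrow> nat" where
  "min_distance Q Ss Ls =
     Inf {weight Q P | P. (\<forall>S\<in>Ss. commute (pauli_string Q P) S) \<and>
                          (\<exists>A\<in>Ls. anticommute (pauli_string Q P) A)}"

text \<open>Parameters \<open>[[n, k, d]]\<close> of a subsystem code with stabilizers \<open>Ss\<close>, gauge qubits \<open>Rg\<close>,
  logical qubits \<open>Rl\<close>, and logical Pauli operators \<open>X\<close>, \<open>Z\<close> for both.\<close>

definition code_parameters ::
  "'q set \<Rightarrow> 'q qop set \<Rightarrow> 'r set \<Rightarrow> 'r set \<Rightarrow> ('r \<Rightarrow> 'q qop) \<Rightarrow> ('r \<Rightarrow> 'q qop) \<Rightarrow>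
     nat \<Rightarrow> nat \<Rightarrow> nat \<Rightarrow> bool" where
  "code_parameters Q Ss Rg Rl X Z n k d \<longleftrightarrow>
     card Q = n \<and>
     Rg \<inter> Rl = {} \<and> encodes Q (codespace Q Ss) (Rg \<union> Rl) X Z \<and> card Rl = k \<and>
     min_distance Q Ss (X ` Rl \<union> Z ` Rl) = d"


section \<open>The subsystem toric code\<close>

text \<open>Vertices have coordinates in \<open>{..<L} \<times> {..<L}\<close>, taken modulo \<open>L\<close>; \<open>x\<close> grows to the east and
  \<open>y\<close> to the north.  \<open>HEdge (x, y)\<close> joins the vertices \<open>(x, y)\<close> and \<open>(x + 1, y)\<close>, \<open>VEdge (x, y)\<close>
  joins \<open>(x, y)\<close> and \<open>(x, y + 1)\<close>, and a plaquette is identified with its south-west corner.\<close>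

type_synonym site = "nat \<times> nat"

datatype qubit = Vertex site | HEdge site | VEdge site

definition sites :: "nat \<Rightarrow> site set" where
  "sites L = {..<L} \<times> {..<L}"

abbreviation plaquettes :: "nat \<Rightarrow> site set" where
  "plaquettes \<equiv> sites"

definition qubits :: "nat \<Rightarrow> qubit set" where
  "qubits L = Vertex ` sites L \<union> HEdge ` sites L \<union> VEdge ` sites L"

definition east :: "nat \<Rightarrow> site \<Rightarrow> site" where
  "east L p = (Suc (fst p) mod L, snd p)"

definition north :: "nat \<Rightarrow> site \<Rightarrow> site" where
  "north L p = (fst p, Suc (snd p) mod L)"

datatype corner = SW | SE | NW | NE

text \<open>The edges of the plaquette \<open>p\<close> are \<open>HEdge p\<close> (south), \<open>HEdge (north L p)\<close>,
  \<open>VEdge p\<close> (west) and \<open>VEdge (east L p)\<close>.\<close>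

fun triangle :: "nat \<Rightarrow> corner \<Rightarrow> site \<Rightarrow> qubit \<times> qubit \<times> qubit" where
  "triangle L SW p = (Vertex p, HEdge p, VEdge p)"
| "triangle L SE p = (Vertex (east L p), HEdge p, VEdge (east L p))"
| "triangle L NW p = (Vertex (north L p), HEdge (north L p), VEdge p)"
| "triangle L NE p = (Vertex (east L (north L p)), HEdge (north L p), VEdge (east L p))"

definition G :: "nat \<Rightarrow> corner \<Rightarrow> site \<Rightarrow> qubit qop" where
  "G L c p =
     (let \<sigma> = (if c = SW \<or> c = NE then pauli_X (qubits L) else pauli_Z (qubits L));
          (u, f, g) = triangle L c p
      in \<sigma> u \<circ> \<sigma> f \<circ> \<sigma> g)"

definition SX :: "nat \<Rightarrow> site \<Rightarrow> qubit qop" where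
  "SX L p = G L SW p \<circ> G L NE p"

definition SZ :: "nat \<Rightarrow> site \<Rightarrow> qubit qop" where
  "SZ L p = G L SE p \<circ> G L NW p"

definition stabilizers :: "nat \<Rightarrow> qubit qop set" where
  "stabilizers L = SX L ` plaquettes L \<union> SZ L ` plaquettes L"

definition stabilizer_group :: "nat \<Rightarrow> qubit qop set" where
  "stabilizer_group L = generate (pauli_group (qubits L)) (stabilizers L)"

definition hline :: "nat \<Rightarrow> nat \<Rightarrow> qubit set" where
  "hline L y = (\<Union>x<L. {Vertex (x, y), HEdge (x, y)})"

definition vline :: "nat \<Rightarrow> nat \<Rightarrow> qubit set" where
  "vline L x = (\<Union>y<L. {Vertex (x, y), VEdge (x, y)})"

text \<open>Encoded qubits: a gauge qubit for each plaquette and the logical qubits 1 and 2.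
  The parameters \<open>\<Gamma>\<close> and \<open>\<Lambda>\<close> are the chosen horizontal and vertical line.\<close>

datatype encoded = Gauge site | Logical nat

definition gauge_qubits :: "nat \<Rightarrow> encoded set" where
  "gauge_qubits L = Gauge ` plaquettes L"

definition logical_qubits :: "encoded set" where
  "logical_qubits = {Logical 1, Logical 2}"

fun logical_X :: "nat \<Rightarrow> qubit set \<Rightarrow> qubit set \<Rightarrow> encoded \<Rightarrow> qubit qop" where
  "logical_X L \<Gamma> \<Lambda> (Gauge p) = G L SW p"
| "logical_X L \<Gamma> \<Lambda> (Logical i) =
     op_prod (qubits L) (pauli_X (qubits L)) (if i = 1 then \<Gamma> else \<Lambda>)"

fun logical_Z :: "nat \<Rightarrow> qubit set \<Rightarrow> qubit set \<Rightarrow> encoded \<Rightarrow> qubit qop" where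
  "logical_Z L \<Gamma> \<Lambda> (Gauge p) = G L SE p"
| "logical_Z L \<Gamma> \<Lambda> (Logical i) =
     op_prod (qubits L) (pauli_Z (qubits L)) (if i = 1 then \<Lambda> else \<Gamma>)"

end

theory Submission
  imports Defs
begin

text \<open>
  A product of Pauli operators is, up to a phase, given by the sets \<open>A\<close> and \<open>B\<close> of qubits on which it
  acts by \<open>X\<close> and by \<open>Z\<close>, and two such operators commute or anticommute according to the parities
  of \<open>A \<inter> B'\<close> and \<open>A' \<inter> B\<close>.  Every generator here is purely of type \<open>X\<close> or purely of type \<open>Z\<close>, so
  a code state is a function on the quotient \<open>V / W\<close>, where \<open>W\<close> is spanned by the supports of the
  \<open>S\<^sup>X\<^sub>p\<close> and \<open>V\<close> consists of the sets meeting the support of every \<open>S\<^sup>Z\<^sub>p\<close> evenly.  The parities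
  against the logical \<open>Z\<close> operators identify \<open>V / W\<close> with the subsets of the encoded qubits: a set
  that meets all triangles of type \<open>Z\<close>, \<open>\<Gamma>\<close> and \<open>\<Lambda>\<close> evenly is a closed form on the torus without
  periods, hence has a potential \<open>m\<close>, and \<open>m\<close> says which \<open>S\<^sup>X\<^sub>p\<close> to multiply.

  For the distance, all parallel lines differ by products of stabilizers, so an error that
  anticommutes with a logical operator on one line anticommutes with its translates to all \<open>L\<close>
  disjoint parallel lines and meets each of them.
\<close>

section \<open>Pauli operators and the sign pairing\<close>

text \<open>Parities are kept as complex signs instead of bits: such a sign is itself the eigenvalue
  or the commutation phase, and additivity over GF(2) becomes a law about products, so that no rank
  of a matrix over GF(2) has to be computed. The dimension comes from explicit representatives of
  the cosets. The closed form arises because the gauge operator Z of a plaquette is its SE triangle: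
  once that sign is trivial, S^Z forces the NW sign to be trivial too. An SE and an NW triangle with
  the same vertex but in different plaquettes then give, after elimination of the vertex, a relation
  between the four edges at it. This is closedness on the dual lattice, whose points are the
  plaquettes. The free constant in the potential is the dependency among all S^X. The bare logical
  operators have weight 2L, but an error has to commute with the stabilizers only, not with the
  triangles, and multiplication by triangles lowers the weight to L. The lower bound must cover
  these dressed errors, and therefore lines may be moved by stabilizers only.\<close>

definition pm :: "bool \<Rightarrow> complex" where
  "pm b = (if b then - 1 else 1)"

lemma pm_simps [simp]: "pm True = - 1" "pm False = 1" "pm b * pm b = 1" "pm b \<noteq> 0"
  by (auto simp: pm_def)

lemma pm_mult_self_left [simp]: "pm b * (pm b * z) = z"
  by (auto simp: pm_def)

lemma pm_eq_iff [simp]: "pm a = pm b \<longleftrightarrow> a = b"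
  by (auto simp: pm_def)

lemma pm_mem_sym_diff: "pm (j \<in> sym_diff A B) = pm (j \<in> A) * pm (j \<in> B)"
  by (auto simp: pm_def)

lemma prod_pm_delta:
  assumes "finite I"
  shows "(\<Prod>i\<in>I. pm (i = a)) = pm (a \<in> I)" "(\<Prod>i\<in>I. pm (a = i)) = pm (a \<in> I)"
  using prod.delta[OF assms, of a "\<lambda>_. - 1 :: complex"]
    prod.delta'[OF assms, of a "\<lambda>_. - 1 :: complex"]
  by (simp_all add: pm_def if_distrib cong: if_cong)

text \<open>The parity of \<open>card (A \<inter> B)\<close> as a sign, i.e. the symplectic pairing of an \<open>X\<close>-type with a
  \<open>Z\<close>-type Pauli operator.\<close>

definition chi :: "'a set \<Rightarrow> 'a set \<Rightarrow> complex" where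
  "chi A B = (\<Prod>j\<in>A. pm (j \<in> B))"

lemma chi_eq_prod_Int:
  assumes "finite A"
  shows "chi A B = (\<Prod>j\<in>A \<inter> B. - 1)"
proof -
  have "chi A B = (\<Prod>j\<in>A. if j \<in> B then - 1 else 1)" by (simp add: chi_def pm_def)
  also have "\<dots> = (\<Prod>j\<in>A \<inter> B. - 1)" by (rule prod.inter_restrict[OF assms, symmetric])
  finally show ?thesis .
qed

lemma chi_commute: "finite A \<Longrightarrow> finite B \<Longrightarrow> chi A B = chi B A"
  by (simp add: chi_eq_prod_Int Int_commute)

lemma chi_empty [simp]: "chi {} B = 1" "chi A {} = 1"
  by (simp_all add: chi_def)

lemma chi_insert: "finite A \<Longrightarrow> j \<notin> A \<Longrightarrow> chi (insert j A) B = pm (j \<in> B) * chi A B"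
  by (simp add: chi_def)

lemma chi_square [simp]: "chi A B * chi A B = 1"
  by (simp add: chi_def flip: prod.distrib)

lemma chi_cases: "chi A B = 1 \<or> chi A B = - 1"
  using chi_square[of A B] square_eq_1_iff by blast

lemma chi_nonzero [simp]: "chi A B \<noteq> 0"
  using chi_cases[of A B] by auto

lemma chi_sym_diff_right: "chi A (sym_diff B C) = chi A B * chi A C"
  by (simp only: chi_def pm_mem_sym_diff prod.distrib)

lemma chi_sym_diff_left:
  assumes "finite A" "finite B"
  shows "chi (sym_diff A B) C = chi A C * chi B C"
proof -
  have "chi A C = chi (A \<inter> B) C * chi (A - B) C" "chi B C = chi (A \<inter> B) C * chi (B - A) C"
    using prod.Int_Diff[OF assms(1), of _ B] prod.Int_Diff[OF assms(2), of _ A]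
    by (simp_all add: chi_def Int_commute)
  moreover have "chi (sym_diff A B) C = chi (A - B) C * chi (B - A) C"
    unfolding chi_def using assms by (intro prod.union_disjoint) auto
  ultimately show ?thesis by (simp add: ac_simps)
qed

text \<open>The sum over GF(2) of the indicator vectors of the \<open>f i\<close>. Counting parities
  pointwise avoids the choice of an order that a fold of \<open>sym_diff\<close> would bring
  in.\<close>

definition ssum :: "('i \<Rightarrow> 'a set) \<Rightarrow> 'i set \<Rightarrow> 'a set" where
  "ssum f I = {j. odd (card {i\<in>I. j \<in> f i})}"

lemma ssum_empty [simp]: "ssum f {} = {}"
  by (simp add: ssum_def)

lemma ssum_insert:
  assumes "finite I" "i \<notin> I"
  shows "ssum f (insert i I) = sym_diff (f i) (ssum f I)"
proof -
  have "{k \<in> insert i I. j \<in> f k} =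
      (if j \<in> f i then insert i {k \<in> I. j \<in> f k} else {k \<in> I. j \<in> f k})" for j
    by auto
  with assms show ?thesis by (auto simp: ssum_def)
qed

lemma pm_mem_ssum: "finite I \<Longrightarrow> pm (j \<in> ssum f I) = (\<Prod>i\<in>I. pm (j \<in> f i))"
  by (induction I rule: finite_induct) (simp_all add: ssum_insert pm_mem_sym_diff del: Un_iff)

lemma ssum_subset:
  assumes "\<And>i. i \<in> I \<Longrightarrow> f i \<subseteq> Q"
  shows "ssum f I \<subseteq> Q"
proof
  fix j assume "j \<in> ssum f I"
  then have "{i \<in> I. j \<in> f i} \<noteq> {}" unfolding ssum_def by force
  then show "j \<in> Q" using assms by blast
qed

lemma chi_ssum_left:
  assumes "finite I" "\<And>i. i \<in> I \<Longrightarrow> finite (f i)"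
  shows "chi (ssum f I) B = (\<Prod>i\<in>I. chi (f i) B)"
  using assms
proof (induction I rule: finite_induct)
  case (insert i I)
  have "finite (ssum f I)"
    by (rule finite_subset[OF ssum_subset[of _ _ "\<Union>i\<in>I. f i"]]) (use insert in auto)
  with insert show ?case by (simp add: ssum_insert chi_sym_diff_left)
qed simp

lemma chi_ssum_right: "finite I \<Longrightarrow> chi A (ssum f I) = (\<Prod>i\<in>I. chi A (f i))"
  by (induction I rule: finite_induct) (simp_all add: ssum_insert chi_sym_diff_right)

text \<open>Flipping an encoded qubit, as \<open>pauli_X\<close> does on index sets, thus amounts to
  adding the support of its logical X.\<close>

lemma ssum_flip:
  assumes "finite I"
  shows "ssum f (if i \<in> I then I - {i} else insert i I) = sym_diff (ssum f I) (f i)"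
proof (cases "i \<in> I")
  case True
  then have "ssum f I = sym_diff (f i) (ssum f (I - {i}))"
    using assms ssum_insert[of "I - {i}" i f] by (simp add: insert_absorb)
  with True show ?thesis by auto
next
  case False
  then show ?thesis using assms by (auto simp: ssum_insert)
qed

text \<open>Normal form of a Pauli operator: \<open>c\<close> times Z on \<open>B\<close> times X on
  \<open>A\<close>, with the X part acting first. This order fixes all phases that occur
  later.\<close>

definition pauli_op :: "'q set \<Rightarrow> complex \<Rightarrow> 'q set \<Rightarrow> 'q set \<Rightarrow> 'q qop" where
  "pauli_op Q c A B \<psi> = (\<lambda>s. if s \<subseteq> Q then c * chi B s * \<psi> (sym_diff s A) else 0)"

lemma id_op_eq_pauli_op: "id_op Q = pauli_op Q 1 {} {}"
  by (simp add: id_op_def pauli_op_def fun_eq_iff)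

lemma pauli_X_eq_pauli_op: "pauli_X Q j = pauli_op Q 1 {j} {}"
proof -
  have "(if j \<in> s then s - {j} else insert j s) = sym_diff s {j}" for s by auto
  then show ?thesis by (simp only: pauli_X_def pauli_op_def fun_eq_iff) auto
qed

lemma pauli_Z_eq_pauli_op: "pauli_Z Q j = pauli_op Q 1 {} {j}"
  by (auto simp: pauli_Z_def pauli_op_def chi_def fun_eq_iff)

text \<open>The sign \<open>chi B' A\<close> is the price of moving the flips of the left factor
  past the signs of the right one.\<close>

lemma pauli_op_comp:
  assumes "A \<subseteq> Q" "finite B" "finite B'"
  shows "pauli_op Q c A B \<circ> pauli_op Q c' A' B'
    = pauli_op Q (c * c' * chi B' A) (sym_diff A A') (sym_diff B B')"
proof (intro ext)
  fix \<psi> s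
  have *: "sym_diff s A \<subseteq> Q \<longleftrightarrow> s \<subseteq> Q" using assms by auto
  have **: "sym_diff (sym_diff s A) A' = sym_diff s (sym_diff A A')" by blast
  show "(pauli_op Q c A B \<circ> pauli_op Q c' A' B') \<psi> s
      = pauli_op Q (c * c' * chi B' A) (sym_diff A A') (sym_diff B B') \<psi> s"
    unfolding pauli_op_def comp_def * **
    by (simp only: chi_sym_diff_left[OF assms(2,3)] chi_sym_diff_right) simp
qed

lemma pauli_op_eqD:
  assumes eq: "pauli_op Q c A B = pauli_op Q c' A' B'"
    and "c \<noteq> 0" "A \<subseteq> Q" "B \<subseteq> Q" "B' \<subseteq> Q" "finite Q"
  shows "c = c'" "A = A'" "B = B'"
proof -
  have fin: "finite B" "finite B'" using assms finite_subset by blast+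
  \<comment> \<open>At the empty set the operator returns \<open>c * \<psi> A\<close>, since
    \<open>chi B {} = 1\<close>; the basis vector of \<open>A\<close> therefore isolates
    \<open>c\<close> and \<open>A\<close>.\<close>
  define \<psi> :: "'a state" where "\<psi> = (\<lambda>s. if s = A then 1 else 0)"
  have "pauli_op Q c A B \<psi> {} = pauli_op Q c' A' B' \<psi> {}" by (simp add: eq)
  then have "c = c' * (if A' = A then 1 else 0)" by (simp add: pauli_op_def \<psi>_def)
  with \<open>c \<noteq> 0\<close> show cA: "c = c'" "A = A'" by (auto split: if_splits)
  have "j \<in> B \<longleftrightarrow> j \<in> B'" if "j \<in> Q" for j
  proof -
    \<comment> \<open>A constant state is blind to \<open>A\<close>, so the value at a singleton
      reveals whether \<open>j\<close> belongs to \<open>B\<close>.\<close>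
    define \<phi> :: "'a state" where "\<phi> = (\<lambda>s. 1)"
    have "pauli_op Q c A B \<phi> {j} = pauli_op Q c' A' B' \<phi> {j}" by (simp add: eq)
    with that cA \<open>c \<noteq> 0\<close> have "chi B {j} = chi B' {j}" by (simp add: pauli_op_def \<phi>_def)
    then have "chi {j} B = chi {j} B'" using fin by (simp add: chi_commute[of B] chi_commute[of B'])
    then show ?thesis by (simp add: chi_insert)
  qed
  with assms show "B = B'" by blast
qed

lemma scale_pauli_op: "scale_state a (pauli_op Q c A B \<psi>) = pauli_op Q (a * c) A B \<psi>"
  by (auto simp: scale_state_def pauli_op_def)

text \<open>Both orders of composition have the same supports and differ in the phase only.
  Uniqueness of the normal form makes this an equivalence, and so parities can also be read off from
  a given commutation relation.\<close>

lemma pauli_op_commute_iff: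
  assumes "c \<noteq> 0" "c' \<noteq> 0" "finite Q" "A \<subseteq> Q" "B \<subseteq> Q" "A' \<subseteq> Q" "B' \<subseteq> Q"
  shows "commute (pauli_op Q c A B) (pauli_op Q c' A' B') \<longleftrightarrow> chi B' A = chi B A'"
    and "anticommute (pauli_op Q c A B) (pauli_op Q c' A' B') \<longleftrightarrow> chi B' A = - chi B A'"
proof -
  have fin: "finite B" "finite B'" using assms finite_subset by blast+
  have AB: "sym_diff A' A = sym_diff A A'" "sym_diff B' B = sym_diff B B'" by blast+
  have sub: "sym_diff A A' \<subseteq> Q" "sym_diff B B' \<subseteq> Q" using assms by blast+
  have 1: "pauli_op Q c A B \<circ> pauli_op Q c' A' B'
      = pauli_op Q (c * c' * chi B' A) (sym_diff A A') (sym_diff B B')"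
    using assms fin by (intro pauli_op_comp)
  have 2: "pauli_op Q c' A' B' \<circ> pauli_op Q c A B
      = pauli_op Q (c' * c * chi B A') (sym_diff A A') (sym_diff B B')"
    using assms fin by (subst pauli_op_comp) (simp_all only: AB)
  have nz: "c * c' * chi B' A \<noteq> 0" using assms by simp
  have "c * c' * x = a * (c' * c * y) \<longleftrightarrow> (c * c') * x = (c * c') * (a * y)" for a x y :: complex
    by (simp add: ac_simps)
  then have cancel: "c * c' * x = a * (c' * c * y) \<longleftrightarrow> x = a * y" for a x y :: complex
    using assms(1,2) by (simp only: mult_left_cancel mult_eq_0_iff not_False_eq_True simp_thms)
  \<comment> \<open>The factor \<open>a\<close> is 1 for commuting and -1 for anticommuting, which
    treats both claims at once.\<close>
  have 3: "pauli_op Q (c * c' * chi B' A) (sym_diff A A') (sym_diff B B')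
      = pauli_op Q (a * (c' * c * chi B A')) (sym_diff A A') (sym_diff B B')
      \<longleftrightarrow> c * c' * chi B' A = a * (c' * c * chi B A')" for a
  proof
    assume "pauli_op Q (c * c' * chi B' A) (sym_diff A A') (sym_diff B B')
      = pauli_op Q (a * (c' * c * chi B A')) (sym_diff A A') (sym_diff B B')"
    from pauli_op_eqD(1)[OF this nz sub(1,2) sub(2) \<open>finite Q\<close>]
    show "c * c' * chi B' A = a * (c' * c * chi B A')" .
  qed (simp only:)
  show "commute (pauli_op Q c A B) (pauli_op Q c' A' B') \<longleftrightarrow> chi B' A = chi B A'"
    unfolding commute_def 1 2 using 3[of 1] cancel[of _ 1] by simp
  have "(\<lambda>\<psi>. scale_state (- 1) (pauli_op Q c' A' B' (pauli_op Q c A B \<psi>)))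
      = (\<lambda>\<psi>. scale_state (- 1) ((pauli_op Q c' A' B' \<circ> pauli_op Q c A B) \<psi>))" by simp
  also have "\<dots> = pauli_op Q (- 1 * (c' * c * chi B A')) (sym_diff A A') (sym_diff B B')"
    unfolding 2 scale_pauli_op ..
  finally have 4: "(\<lambda>\<psi>. scale_state (- 1) (pauli_op Q c' A' B' (pauli_op Q c A B \<psi>)))
      = pauli_op Q (- 1 * (c' * c * chi B A')) (sym_diff A A') (sym_diff B B')" .
  show "anticommute (pauli_op Q c A B) (pauli_op Q c' A' B') \<longleftrightarrow> chi B' A = - chi B A'"
    unfolding anticommute_def 1 4 3 cancel by simp
qed

abbreviation x_op :: "'q set \<Rightarrow> 'q set \<Rightarrow> 'q qop" where
  "x_op Q A \<equiv> pauli_op Q 1 A {}"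

abbreviation z_op :: "'q set \<Rightarrow> 'q set \<Rightarrow> 'q qop" where
  "z_op Q B \<equiv> pauli_op Q 1 {} B"

section \<open>Products of commuting Pauli operators\<close>

lemma op_prod_empty [simp]: "op_prod Q f {} = id_op Q"
  by (simp add: op_prod_def)

lemma op_prod_insert:
  assumes "finite A" "a \<notin> A"
    and "\<And>b c. b \<in> insert a A \<Longrightarrow> c \<in> insert a A \<Longrightarrow> commute (f b) (f c)"
  shows "op_prod Q f (insert a A) = f a \<circ> op_prod Q f A"
proof -
  interpret comp_fun_commute_on "insert a A" "\<lambda>a T. f a \<circ> T"
    using assms(3) by unfold_locales (simp add: fun_eq_iff commute_def)
  show ?thesis unfolding op_prod_def using assms(1,2) by (intro fold_insert) auto
qed

lemma op_prod_x_op: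
  assumes "finite Q" "finite I" "\<And>i. i \<in> I \<Longrightarrow> f i = x_op Q (A i)" "\<And>i. i \<in> I \<Longrightarrow> A i \<subseteq> Q"
  shows "op_prod Q f I = x_op Q (ssum A I)"
  using assms(2-)
proof (induction I rule: finite_induct)
  case empty
  then show ?case by (simp add: id_op_eq_pauli_op)
next
  case (insert i I)
  have "op_prod Q f (insert i I) = f i \<circ> op_prod Q f I"
    using insert.hyps
  proof (rule op_prod_insert)
    fix b c assume "b \<in> insert i I" "c \<in> insert i I"
    with insert.prems \<open>finite Q\<close> show "commute (f b) (f c)" by (simp add: pauli_op_commute_iff)
  qed
  then show ?case using insert by (simp add: pauli_op_comp ssum_insert)
qed

lemma op_prod_z_op:
  assumes "finite Q" "finite I" "\<And>i. i \<in> I \<Longrightarrow> f i = z_op Q (B i)" "\<And>i. i \<in> I \<Longrightarrow> B i \<subseteq> Q"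
  shows "op_prod Q f I = z_op Q (ssum B I)"
  using assms(2-)
proof (induction I rule: finite_induct)
  case empty
  then show ?case by (simp add: id_op_eq_pauli_op)
next
  case (insert i I)
  have "op_prod Q f (insert i I) = f i \<circ> op_prod Q f I"
    using insert.hyps
  proof (rule op_prod_insert)
    fix b c assume "b \<in> insert i I" "c \<in> insert i I"
    with insert.prems \<open>finite Q\<close> show "commute (f b) (f c)" by (simp add: pauli_op_commute_iff)
  qed
  moreover have "finite (B i)" "finite (ssum B I)"
    using insert.prems \<open>finite Q\<close> finite_subset[OF ssum_subset[of I B Q] \<open>finite Q\<close>]
    by (auto intro: finite_subset)
  ultimately show ?case using insert by (simp add: pauli_op_comp ssum_insert)
qed

lemma ssum_singleton: "ssum (\<lambda>j. {j}) I = I"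
proof -
  have "{i \<in> I. j \<in> {i}} = (if j \<in> I then {j} else {})" for j by auto
  then show ?thesis by (auto simp: ssum_def)
qed

lemma op_prod_pauli_X:
  assumes "finite Q" "A \<subseteq> Q"
  shows "op_prod Q (pauli_X Q) A = x_op Q A"
  using op_prod_x_op[of Q A "pauli_X Q" "\<lambda>j. {j}"] assms finite_subset[of A Q]
  by (auto simp: pauli_X_eq_pauli_op ssum_singleton)

lemma op_prod_pauli_Z:
  assumes "finite Q" "B \<subseteq> Q"
  shows "op_prod Q (pauli_Z Q) B = z_op Q B"
  using op_prod_z_op[of Q B "pauli_Z Q" "\<lambda>j. {j}"] assms finite_subset[of B Q]
  by (auto simp: pauli_Z_eq_pauli_op ssum_singleton)

section \<open>Pauli strings in normal form\<close>

definition x_part :: "'q set \<Rightarrow> ('q \<Rightarrow> pauli) \<Rightarrow> 'q set" where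
  "x_part Q P = {j \<in> Q. P j = PX \<or> P j = PY}"

definition z_part :: "'q set \<Rightarrow> ('q \<Rightarrow> pauli) \<Rightarrow> 'q set" where
  "z_part Q P = {j \<in> Q. P j = PZ \<or> P j = PY}"

text \<open>Y is \<open>\<i>\<close> times X after Z, while the normal form applies X first;
  exchanging the two turns \<open>\<i>\<close> into \<open>- \<i>\<close>.\<close>

lemma pauli_Y_eq_pauli_op: 
  assumes "j \<in> Q"
  shows "pauli_Y Q j = pauli_op Q (- \<i>) {j} {j}"
proof
  fix \<psi> 
  have "pauli_Y Q j \<psi> = scale_state \<i> ((x_op Q {j} \<circ> z_op Q {j}) \<psi>)"
    by (simp add: pauli_Y_def pauli_X_eq_pauli_op pauli_Z_eq_pauli_op)
  also have "x_op Q {j} \<circ> z_op Q {j} = pauli_op Q (- 1) {j} {j}"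
    using assms by (simp add: pauli_op_comp chi_insert)
  finally show "pauli_Y Q j \<psi> = pauli_op Q (- \<i>) {j} {j} \<psi>"
    by (simp add: scale_pauli_op)
qed

definition y_phase :: "('q \<Rightarrow> pauli) \<Rightarrow> 'q \<Rightarrow> complex" where
  "y_phase P j = (if P j = PY then - \<i> else 1)"

lemma pauli_at_eq_pauli_op:
  assumes "j \<in> Q"
  shows "pauli_at Q (P j) j = pauli_op Q (y_phase P j) (x_part {j} P) (z_part {j} P)"
proof (cases "P j")
qed (use assms in \<open>simp_all add: id_op_eq_pauli_op pauli_X_eq_pauli_op pauli_Y_eq_pauli_op
    pauli_Z_eq_pauli_op y_phase_def x_part_def z_part_def cong: conj_cong\<close>)

lemma pauli_string_eq_pauli_op:
  assumes "finite Q"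
  shows "pauli_string Q P = pauli_op Q (\<Prod>j\<in>Q. y_phase P j) (x_part Q P) (z_part Q P)"
proof -
  \<comment> \<open>The induction runs over the qubits acted on, while the Hilbert space stays that
    of \<open>Q\<close>.\<close>
  have "op_prod Q (\<lambda>j. pauli_at Q (P j) j) I
      = pauli_op Q (\<Prod>j\<in>I. y_phase P j) (x_part I P) (z_part I P)" if "I \<subseteq> Q" for I
    using finite_subset[OF that assms] that
  proof (induction I rule: finite_induct)
    case empty
    then show ?case by (simp add: id_op_eq_pauli_op x_part_def z_part_def)
  next
    case (insert i I)
    have "op_prod Q (\<lambda>j. pauli_at Q (P j) j) (insert i I)
        = pauli_at Q (P i) i \<circ> op_prod Q (\<lambda>j. pauli_at Q (P j) j) I"
      using insert.hyps
    proof (rule op_prod_insert)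
      fix b c assume bc: "b \<in> insert i I" "c \<in> insert i I"
      \<comment> \<open>For \<open>b = c\<close> the two sides coincide; otherwise the supports are
        disjoint and both signs are 1.\<close>
      have "chi (z_part {c} P) (x_part {b} P) = chi (z_part {b} P) (x_part {c} P)"
        by (cases "b = c") (simp_all add: chi_def x_part_def z_part_def)
      moreover have "y_phase P b \<noteq> 0" "y_phase P c \<noteq> 0" by (simp_all add: y_phase_def)
      moreover have "x_part {c} P \<subseteq> Q" "x_part {b} P \<subseteq> Q" "z_part {c} P \<subseteq> Q" "z_part {b} P \<subseteq> Q"
        using bc insert.prems by (auto simp: x_part_def z_part_def)
      ultimately show "commute (pauli_at Q (P b) b) (pauli_at Q (P c) c)"
        using bc insert.prems assms
        by (subst (1 2) pauli_at_eq_pauli_op) (auto simp: pauli_op_commute_iff)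
    qed
    also have "\<dots> = pauli_op Q (y_phase P i) (x_part {i} P) (z_part {i} P)
        \<circ> pauli_op Q (\<Prod>j\<in>I. y_phase P j) (x_part I P) (z_part I P)"
      using insert by (simp add: pauli_at_eq_pauli_op)
    also have "\<dots> = pauli_op Q (y_phase P i * (\<Prod>j\<in>I. y_phase P j) * chi (z_part I P) (x_part {i} P))
        (sym_diff (x_part {i} P) (x_part I P)) (sym_diff (z_part {i} P) (z_part I P))"
      using insert by (intro pauli_op_comp) (auto simp: x_part_def z_part_def)
    \<comment> \<open>Distinct qubits do not interact: \<open>i\<close> lies outside
      \<open>I\<close>, so reordering costs no sign.\<close>
    also have "chi (z_part I P) (x_part {i} P) = 1"
      unfolding chi_def
    proof (intro prod.neutral ballI)
      fix j assume "j \<in> z_part I P"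
      then have "j \<notin> x_part {i} P" using insert.hyps by (auto simp: x_part_def z_part_def)
      then show "pm (j \<in> x_part {i} P) = 1" by simp
    qed
    also have "sym_diff (x_part {i} P) (x_part I P) = x_part (insert i I) P"
      using insert.hyps by (auto simp: x_part_def)
    also have "sym_diff (z_part {i} P) (z_part I P) = z_part (insert i I) P"
      using insert.hyps by (auto simp: z_part_def)
    finally show ?case using insert.hyps by simp
  qed
  then show ?thesis by (simp add: pauli_string_def)
qed

lemma y_phase_prod_nonzero: "finite Q \<Longrightarrow> (\<Prod>j\<in>Q. y_phase P j) \<noteq> 0"
  by (simp add: y_phase_def)

lemma weight_eq_card: "weight Q P = card (x_part Q P \<union> z_part Q P)"
proof -
  have "P j \<noteq> PI \<longleftrightarrow> P j = PX \<or> P j = PY \<or> P j = PZ" for j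
    by (cases "P j") auto
  then have "{j \<in> Q. P j \<noteq> PI} = x_part Q P \<union> z_part Q P"
    by (auto simp: x_part_def z_part_def)
  then show ?thesis by (simp add: weight_def)
qed

lemma x_op_eq_pauli_string:
  assumes "finite Q" "A \<subseteq> Q"
  shows "x_op Q A = pauli_string Q (\<lambda>j. if j \<in> A then PX else PI)"
proof -
  have "x_part Q (\<lambda>j. if j \<in> A then PX else PI) = A" "z_part Q (\<lambda>j. if j \<in> A then PX else PI) = {}"
    using assms by (auto simp: x_part_def z_part_def)
  moreover have "y_phase (\<lambda>j. if j \<in> A then PX else PI) j = 1" for j by (simp add: y_phase_def)
  ultimately show ?thesis using assms by (simp add: pauli_string_eq_pauli_op)
qed

lemma z_op_eq_pauli_string:
  assumes "finite Q" "B \<subseteq> Q"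
  shows "z_op Q B = pauli_string Q (\<lambda>j. if j \<in> B then PZ else PI)"
proof -
  have "z_part Q (\<lambda>j. if j \<in> B then PZ else PI) = B" "x_part Q (\<lambda>j. if j \<in> B then PZ else PI) = {}"
    using assms by (auto simp: x_part_def z_part_def)
  moreover have "y_phase (\<lambda>j. if j \<in> B then PZ else PI) j = 1" for j by (simp add: y_phase_def)
  ultimately show ?thesis using assms by (simp add: pauli_string_eq_pauli_op)
qed

section \<open>Membership and inverses in the Pauli group\<close>

lemma pauli_string_in_pauli_group: "pauli_string Q P \<in> carrier (pauli_group Q)"
proof -
  have "pauli_string Q P = (\<lambda>\<psi>. scale_state 1 (pauli_string Q P \<psi>))"
    by (simp add: scale_state_def)
  then have "\<exists>c P'. pauli_string Q P = (\<lambda>\<psi>. scale_state c (pauli_string Q P' \<psi>)) \<and> c \<in> {1, -1, \<i>, -\<i>}"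
    by blast
  then show ?thesis by (simp add: pauli_group_def)
qed

lemma x_op_z_op_in_pauli_group:
  assumes "finite Q" "A \<subseteq> Q"
  shows "x_op Q A \<in> carrier (pauli_group Q)" "z_op Q A \<in> carrier (pauli_group Q)"
  using x_op_eq_pauli_string[OF assms] z_op_eq_pauli_string[OF assms]
    pauli_string_in_pauli_group by metis+

text \<open>\<open>generate\<close> refers to \<open>m_inv\<close>, a definite description over the
  carrier. Its value is computed from \<open>S \<circ> S = id_op Q\<close> and associativity alone,
  without first establishing the group laws.\<close>

lemma pauli_group_involution_inv:
  assumes "finite Q" "S \<in> carrier (pauli_group Q)" "S \<circ> S = id_op Q"
  shows "inv\<^bsub>pauli_group Q\<^esub> S = S"
proof -
  \<comment> \<open>\<open>id_op Q\<close> differs from \<open>id\<close> outside the Hilbert space;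
    it is neutral for operators in normal form.\<close>
  have id: "id_op Q \<circ> y = y \<and> y \<circ> id_op Q = y" if y: "y \<in> carrier (pauli_group Q)" for y
  proof -
    obtain c P where "y = (\<lambda>\<psi>. scale_state c (pauli_string Q P \<psi>))"
      using y by (auto simp: pauli_group_def)
    then have *: "y = pauli_op Q (c * (\<Prod>j\<in>Q. y_phase P j)) (x_part Q P) (z_part Q P)"
      by (simp add: pauli_string_eq_pauli_op[OF assms(1)] scale_pauli_op fun_eq_iff)
    have fin: "finite (z_part Q P)" "x_part Q P \<subseteq> Q" using assms(1) by (auto simp: z_part_def x_part_def)
    show ?thesis unfolding id_op_eq_pauli_op * using fin by (simp add: pauli_op_comp)
  qed
  have "y = S" if "y \<in> carrier (pauli_group Q)" "S \<circ> y = id_op Q" for y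
    using id[OF that(1)] id[OF assms(2)] assms(3) that(2) by (metis comp_assoc)
  then show ?thesis unfolding m_inv_def using assms
    by (intro the_equality) (auto simp: pauli_group_def)
qed

section \<open>CSS codes\<close>

lemma sum_apply: "(\<Sum>i\<in>I. f i) x = (\<Sum>i\<in>I. f i x)"
  by (induction I rule: infinite_finite_induct) simp_all

text \<open>\<open>hx\<close> and \<open>hz\<close> are the supports of the stabilizers,
  \<open>a\<close> and \<open>b\<close> those of the encoded X and Z operators. All assumptions but
  \<open>kernel\<close> concern single overlaps. \<open>kernel\<close> is exactness: what no
  \<open>hz\<close> and no \<open>b\<close> detects is a sum of \<open>hx\<close>. It takes the
  place of a rank count, and dependent \<open>hx\<close> are allowed.\<close>

locale css =
  fixes Q :: "'q set" and P :: "'p set" and R :: "'r set"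
    and hx hz :: "'p \<Rightarrow> 'q set" and a b :: "'r \<Rightarrow> 'q set"
  assumes finite_Q: "finite Q" and finite_P: "finite P" and finite_R: "finite R"
    and hx_subset: "\<And>p. p \<in> P \<Longrightarrow> hx p \<subseteq> Q" and hz_subset: "\<And>p. p \<in> P \<Longrightarrow> hz p \<subseteq> Q"
    and a_subset: "\<And>e. e \<in> R \<Longrightarrow> a e \<subseteq> Q" and b_subset: "\<And>e. e \<in> R \<Longrightarrow> b e \<subseteq> Q"
    and chi_hz_hx: "\<And>p q. p \<in> P \<Longrightarrow> q \<in> P \<Longrightarrow> chi (hz p) (hx q) = 1"
    and chi_hz_a: "\<And>p e. p \<in> P \<Longrightarrow> e \<in> R \<Longrightarrow> chi (hz p) (a e) = 1"
    and chi_b_hx: "\<And>p e. p \<in> P \<Longrightarrow> e \<in> R \<Longrightarrow> chi (b e) (hx p) = 1"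
    and chi_b_a: "\<And>e f. e \<in> R \<Longrightarrow> f \<in> R \<Longrightarrow> chi (b e) (a f) = pm (e = f)"
    and kernel: "\<And>s. s \<subseteq> Q \<Longrightarrow> (\<And>p. p \<in> P \<Longrightarrow> chi (hz p) s = 1) \<Longrightarrow>
      (\<And>e. e \<in> R \<Longrightarrow> chi (b e) s = 1) \<Longrightarrow> s \<in> ssum hx ` Pow P"
begin

definition V :: "'q set set" where
  "V = {s. s \<subseteq> Q \<and> (\<forall>p\<in>P. chi (hz p) s = 1)}"

definition W :: "'q set set" where
  "W = ssum hx ` Pow P"

definition syn :: "'q set \<Rightarrow> 'r set" where
  "syn s = {e \<in> R. chi (b e) s = - 1}"

text \<open>A section of \<open>syn\<close>: it picks a representative of each coset of
  \<open>W\<close> in \<open>V\<close>.\<close>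

definition rep :: "'r set \<Rightarrow> 'q set" where
  "rep t = ssum a t"

abbreviation code :: "'q state set" where
  "code \<equiv> codespace Q ((\<lambda>p. x_op Q (hx p)) ` P \<union> (\<lambda>p. z_op Q (hz p)) ` P)"

lemma pm_mem_syn: "e \<in> R \<Longrightarrow> pm (e \<in> syn s) = chi (b e) s"
  using chi_cases[of "b e" s] by (auto simp: syn_def pm_def)

text \<open>A Z-type stabilizer multiplies an amplitude by a sign, so a negative sign forces the
  amplitude to vanish; an X-type stabilizer only moves amplitudes. Sets not contained in
  \<open>Q\<close> lie outside \<open>V\<close>, which absorbs the membership in
  \<open>hilbert Q\<close>.\<close>

lemma code_iff:
  "\<psi> \<in> code \<longleftrightarrow> (\<forall>s. s \<notin> V \<longrightarrow> \<psi> s = 0) \<and> (\<forall>s p. s \<subseteq> Q \<longrightarrow> p \<in> P \<longrightarrow> \<psi> (sym_diff s (hx p)) = \<psi> s)"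
proof -
  have x: "x_op Q (hx p) \<psi> = \<psi> \<longleftrightarrow> (\<forall>s. s \<subseteq> Q \<longrightarrow> \<psi> (sym_diff s (hx p)) = \<psi> s)"
    and z: "z_op Q (hz p) \<psi> = \<psi> \<longleftrightarrow> (\<forall>s. s \<subseteq> Q \<longrightarrow> chi (hz p) s \<noteq> 1 \<longrightarrow> \<psi> s = 0)"
    if "\<psi> \<in> hilbert Q" for p
    using that by (auto simp: pauli_op_def fun_eq_iff hilbert_def)
  show ?thesis
  proof (cases "\<psi> \<in> hilbert Q")
    case True
    have "(\<forall>p\<in>P. z_op Q (hz p) \<psi> = \<psi>) \<longleftrightarrow> (\<forall>s. s \<notin> V \<longrightarrow> \<psi> s = 0)"
    proof (intro iffI ballI allI impI)
      fix s assume *: "\<forall>p\<in>P. z_op Q (hz p) \<psi> = \<psi>" and "s \<notin> V"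
      show "\<psi> s = 0"
      proof (cases "s \<subseteq> Q")
        case s: True
        with \<open>s \<notin> V\<close> obtain p where "p \<in> P" "chi (hz p) s \<noteq> 1" by (auto simp: V_def)
        with * s show ?thesis using z[OF True, of p] by blast
      qed (use True in \<open>simp add: hilbert_def\<close>)
    next
      fix p assume *: "\<forall>s. s \<notin> V \<longrightarrow> \<psi> s = 0" and "p \<in> P"
      then show "z_op Q (hz p) \<psi> = \<psi>" unfolding z[OF True] by (auto simp: V_def)
    qed
    with True show ?thesis by (auto simp: codespace_def ball_Un x simp del: Un_iff)
  next
    case False
    then obtain s where "\<not> s \<subseteq> Q" "\<psi> s \<noteq> 0" by (auto simp: hilbert_def)
    with False show ?thesis by (auto simp: codespace_def V_def)
  qed
qed

lemma code_shift:
  assumes "\<psi> \<in> code" "s \<subseteq> Q" "w \<in> W"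
  shows "\<psi> (sym_diff s w) = \<psi> s"
proof -
  have "\<psi> (sym_diff s (ssum hx M)) = \<psi> s" if "M \<subseteq> P" for M
    using finite_subset[OF that finite_P] that
  proof (induction M rule: finite_induct)
    case (insert p M)
    have "sym_diff s (ssum hx (insert p M)) = sym_diff (sym_diff s (ssum hx M)) (hx p)"
      unfolding ssum_insert[OF insert.hyps] by blast
    moreover have "sym_diff s (ssum hx M) \<subseteq> Q"
      using assms(2) ssum_subset[of M hx Q] hx_subset insert.prems by blast
    ultimately show ?case using insert assms(1) by (simp add: code_iff)
  qed simp
  then show ?thesis using assms(3) by (auto simp: W_def)
qed

lemma W_subset_Q: "w \<in> W \<Longrightarrow> w \<subseteq> Q"
  unfolding W_def using ssum_subset[of _ hx Q] hx_subset by blast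

lemma chi_W:
  assumes "w \<in> W"
  shows "p \<in> P \<Longrightarrow> chi (hz p) w = 1" "e \<in> R \<Longrightarrow> chi (b e) w = 1"
proof -
  obtain M where M: "M \<subseteq> P" "w = ssum hx M" using assms by (auto simp: W_def)
  have "finite M" using M finite_P finite_subset by blast
  with M show "p \<in> P \<Longrightarrow> chi (hz p) w = 1" "e \<in> R \<Longrightarrow> chi (b e) w = 1"
    by (auto simp: chi_ssum_right chi_hz_hx chi_b_hx subset_iff intro!: prod.neutral)
qed

lemma rep_subset: "t \<subseteq> R \<Longrightarrow> rep t \<subseteq> Q"
  unfolding rep_def using ssum_subset[of t a Q] a_subset by blast

lemma chi_rep:
  assumes "t \<subseteq> R"
  shows "p \<in> P \<Longrightarrow> chi (hz p) (rep t) = 1" "e \<in> R \<Longrightarrow> chi (b e) (rep t) = pm (e \<in> t)"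
proof -
  have fin: "finite t" using assms finite_R finite_subset by blast
  show "p \<in> P \<Longrightarrow> chi (hz p) (rep t) = 1"
    using assms fin by (auto simp: rep_def chi_ssum_right chi_hz_a subset_iff intro!: prod.neutral)
  assume "e \<in> R"
  then have "chi (b e) (rep t) = (\<Prod>f\<in>t. pm (e = f))"
    using assms fin by (auto simp: rep_def chi_ssum_right chi_b_a subset_iff intro!: prod.cong)
  then show "chi (b e) (rep t) = pm (e \<in> t)" using fin by (simp add: prod_pm_delta)
qed

lemma sym_diff_rep_W:
  assumes "t \<subseteq> R" "w \<in> W"
  shows "sym_diff (rep t) w \<in> V" "syn (sym_diff (rep t) w) = t"
proof -
  have "sym_diff (rep t) w \<subseteq> Q" using rep_subset[OF assms(1)] W_subset_Q[OF assms(2)] by blast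
  then show "sym_diff (rep t) w \<in> V"
    using assms by (simp add: V_def chi_sym_diff_right chi_W chi_rep)
  have "e \<in> syn (sym_diff (rep t) w) \<longleftrightarrow> e \<in> t" if "e \<in> R" for e
    using pm_mem_syn[OF that, of "sym_diff (rep t) w"] assms that
    by (simp add: chi_sym_diff_right chi_W chi_rep)
  moreover have "syn s \<subseteq> R" for s by (auto simp: syn_def)
  ultimately show "syn (sym_diff (rep t) w) = t" using assms(1) by blast
qed

lemma empty_in_W: "{} \<in> W"
  unfolding W_def by (rule image_eqI[of _ _ "{}"]) simp_all

lemma rep_in_V: "t \<subseteq> R \<Longrightarrow> rep t \<in> V" and syn_rep: "t \<subseteq> R \<Longrightarrow> syn (rep t) = t"
  using sym_diff_rep_W[OF _ empty_in_W] by simp_all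

lemma syn_subset: "syn s \<subseteq> R"
  by (auto simp: syn_def)

text \<open>This is where exactness enters: \<open>s\<close> and the representative with the same
  \<open>syn\<close> have equal signs against every \<open>hz\<close> and every \<open>b\<close>, so
  their difference is undetected.\<close>

lemma V_decompose:
  assumes "s \<in> V"
  shows "sym_diff (rep (syn s)) s \<in> W"
  unfolding W_def
proof (rule kernel)
  show "sym_diff (rep (syn s)) s \<subseteq> Q"
    using rep_subset[OF syn_subset, of s] assms by (auto simp: V_def)
  show "chi (hz p) (sym_diff (rep (syn s)) s) = 1" if "p \<in> P" for p
    using that assms by (simp add: V_def chi_sym_diff_right chi_rep syn_subset)
  show "chi (b e) (sym_diff (rep (syn s)) s) = 1" if "e \<in> R" for e
    using that by (simp add: chi_sym_diff_right chi_rep syn_subset pm_mem_syn)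
qed

lemma code_eq_rep:
  assumes "\<psi> \<in> code" "s \<in> V"
  shows "\<psi> (rep (syn s)) = \<psi> s"
proof -
  have "sym_diff s (sym_diff (rep (syn s)) s) = rep (syn s)" by blast
  then show ?thesis using code_shift[OF assms(1) _ V_decompose[OF assms(2)], of s] assms(2)
    by (simp add: V_def)
qed

text \<open>Splitting \<open>V\<close> into representative and coset part reduces sums over code
  amplitudes to sums over \<open>Pow R\<close>.\<close>

lemma bij_betw_rep_W: "bij_betw (\<lambda>(t, w). sym_diff (rep t) w) (Pow R \<times> W) V"
proof (rule bij_betwI')
  fix x y assume x: "x \<in> Pow R \<times> W" and y: "y \<in> Pow R \<times> W"
  obtain t w t' w' where xy: "x = (t, w)" "y = (t', w')" by (cases x, cases y)
  have "x = y" if eq: "sym_diff (rep t) w = sym_diff (rep t') w'"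
  proof -
    have t: "t = t'" using sym_diff_rep_W(2)[of t w] sym_diff_rep_W(2)[of t' w'] x y xy eq by auto
    have "w = sym_diff (rep t) (sym_diff (rep t) w)" "w' = sym_diff (rep t') (sym_diff (rep t') w')"
      by blast+
    then have "w = w'" using eq t by metis
    with t show ?thesis by (simp add: xy)
  qed
  then show "((case x of (t, w) \<Rightarrow> sym_diff (rep t) w) = (case y of (t, w) \<Rightarrow> sym_diff (rep t) w))
      = (x = y)" by (auto simp: xy)
next
  fix x assume "x \<in> Pow R \<times> W"
  then show "(case x of (t, w) \<Rightarrow> sym_diff (rep t) w) \<in> V" using sym_diff_rep_W(1) by auto
next
  fix s assume "s \<in> V"
  have "s = sym_diff (rep (syn s)) (sym_diff (rep (syn s)) s)" by blast
  then show "\<exists>x\<in>Pow R \<times> W. s = (case x of (t, w) \<Rightarrow> sym_diff (rep t) w)"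
    using V_decompose[OF \<open>s \<in> V\<close>] syn_subset
    by (intro bexI[of _ "(syn s, sym_diff (rep (syn s)) s)"]) auto
qed

text \<open>The inverse of restricting a code state to representatives.\<close>

definition coset_state :: "('r set \<Rightarrow> complex) \<Rightarrow> 'q state" where
  "coset_state \<phi> s = (if s \<in> V then \<phi> (syn s) else 0)"

lemma coset_state_in_code: "coset_state \<phi> \<in> code"
proof -
  have "coset_state \<phi> (sym_diff s (hx p)) = coset_state \<phi> s" if "s \<subseteq> Q" "p \<in> P" for s p
  proof -
    have "sym_diff s (hx p) \<subseteq> Q" using that hx_subset by blast
    then have "sym_diff s (hx p) \<in> V \<longleftrightarrow> s \<in> V" "syn (sym_diff s (hx p)) = syn s"
      using that by (simp_all add: V_def syn_def chi_sym_diff_right chi_hz_hx chi_b_hx cong: conj_cong)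
    then show ?thesis by (simp add: coset_state_def)
  qed
  then show ?thesis by (simp add: code_iff coset_state_def)
qed

lemma x_op_z_op_code:
  assumes "\<psi> \<in> code" "e \<in> R"
  shows "x_op Q (a e) \<psi> \<in> code" "z_op Q (b e) \<psi> \<in> code"
proof -
  have com: "A (B \<psi>) = B (A \<psi>)" if "commute A B" for A B
    using that by (simp add: commute_def fun_eq_iff)
  have "A (B \<psi>) = B \<psi>" if "A \<in> (\<lambda>p. x_op Q (hx p)) ` P \<union> (\<lambda>p. z_op Q (hz p)) ` P"
    "B = x_op Q (a e) \<or> B = z_op Q (b e)" for A B
  proof -
    have "commute A B"
      using that assms(2) finite_Q hx_subset hz_subset a_subset b_subset
      by (auto simp: pauli_op_commute_iff chi_hz_a chi_b_hx)
    then have "A (B \<psi>) = B (A \<psi>)" by (rule com)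
    also have "A \<psi> = \<psi>" using assms(1) that(1) by (auto simp: codespace_def)
    finally show ?thesis .
  qed
  moreover have "pauli_op Q c A B \<psi> \<in> hilbert Q" for c A B
    by (simp add: hilbert_def pauli_op_def)
  ultimately show "x_op Q (a e) \<psi> \<in> code" "z_op Q (b e) \<psi> \<in> code"
    unfolding codespace_def by blast+
qed

lemma finite_W: "finite W"
  by (simp add: W_def finite_P)

lemma card_W_pos: "card W > 0"
  using finite_W empty_in_W by (auto simp: card_gt_0_iff)

text \<open>A code state is constant on cosets of \<open>W\<close> in \<open>V\<close> and vanishes outside \<open>V\<close>, and \<open>syn\<close>
  identifies \<open>V / W\<close> with \<open>Pow R\<close>.\<close>

theorem encodes_code: "encodes Q code R (\<lambda>e. x_op Q (a e)) (\<lambda>e. z_op Q (b e))"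
proof -
  \<comment> \<open>Each amplitude at a representative stands for \<open>card W\<close> equal
    amplitudes of the code state; the square root makes \<open>U\<close> preserve inner
    products.\<close>
  define k where "k = complex_of_real (sqrt (card W))"
  have k: "k \<noteq> 0" "cnj k = k" "k * k = of_nat (card W)"
    using card_W_pos by (simp_all add: k_def flip: of_real_mult)
  define U :: "'q state \<Rightarrow> 'r state" where "U \<psi> t = (if t \<subseteq> R then k * \<psi> (rep t) else 0)" for \<psi> t
  show ?thesis
    unfolding encodes_def
  proof (intro exI[of _ U] conjI allI ballI)
    show "bij_betw U code (hilbert R)"
    proof (rule bij_betwI')
      fix \<psi> \<phi> assume C: "\<psi> \<in> code" "\<phi> \<in> code"
      show "U \<psi> = U \<phi> \<longleftrightarrow> \<psi> = \<phi>"
      proof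
        assume eq: "U \<psi> = U \<phi>"
        show "\<psi> = \<phi>"
        proof
          fix s
          show "\<psi> s = \<phi> s"
          proof (cases "s \<in> V")
            case True
            have "U \<psi> (syn s) = U \<phi> (syn s)" by (simp add: eq)
            then have "\<psi> (rep (syn s)) = \<phi> (rep (syn s))" using k by (simp add: U_def syn_subset)
            with C True show ?thesis by (simp add: code_eq_rep)
          qed (use C in \<open>simp add: code_iff\<close>)
        qed
      qed simp
    next
      fix \<psi> show "U \<psi> \<in> hilbert R" by (simp add: U_def hilbert_def)
    next
      fix \<phi> :: "'r state" assume \<phi>: "\<phi> \<in> hilbert R"
      have "U (coset_state (\<lambda>t. \<phi> t / k)) = \<phi>"
        using \<phi> k by (auto simp: fun_eq_iff U_def hilbert_def coset_state_def rep_in_V syn_rep)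
      then show "\<exists>\<psi>\<in>code. \<phi> = U \<psi>" using coset_state_in_code by metis
    qed
  next
    fix \<phi> \<psi> assume C: "\<phi> \<in> code" "\<psi> \<in> code"
    show "U (\<phi> + \<psi>) = U \<phi> + U \<psi>"
      by (auto simp: U_def fun_eq_iff algebra_simps)
    show "state_inner R (U \<phi>) (U \<psi>) = state_inner Q \<phi> \<psi>"
    proof -
      have V: "V \<subseteq> Pow Q" by (auto simp: V_def)
      have "state_inner Q \<phi> \<psi> = (\<Sum>s\<in>V. cnj (\<phi> s) * \<psi> s)"
        unfolding state_inner_def using finite_Q V C
        by (intro sum.mono_neutral_right) (auto simp: code_iff)
      also have "\<dots> = (\<Sum>(t, w)\<in>Pow R \<times> W. cnj (\<phi> (sym_diff (rep t) w)) * \<psi> (sym_diff (rep t) w))"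
        unfolding sum.reindex_bij_betw[OF bij_betw_rep_W, symmetric] by (simp add: case_prod_unfold)
      also have "\<dots> = (\<Sum>(t, w)\<in>Pow R \<times> W. cnj (\<phi> (rep t)) * \<psi> (rep t))"
        using C by (intro sum.cong) (auto simp: code_shift rep_subset simp del: Un_iff)
      also have "\<dots> = (\<Sum>t\<in>Pow R. (k * k) * (cnj (\<phi> (rep t)) * \<psi> (rep t)))"
        by (simp add: k flip: sum.cartesian_product)
      also have "\<dots> = state_inner R (U \<phi>) (U \<psi>)"
        unfolding state_inner_def by (intro sum.cong) (simp_all add: U_def k mult_ac)
      finally show ?thesis ..
    qed
  next
    fix c \<psi>
    show "U (scale_state c \<psi>) = scale_state c (U \<psi>)"
      by (auto simp: U_def fun_eq_iff scale_state_def)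
  next
    fix e \<psi> assume e: "e \<in> R" and C: "\<psi> \<in> code"
    show "x_op Q (a e) \<psi> \<in> code" "z_op Q (b e) \<psi> \<in> code"
      using x_op_z_op_code[OF C e] .
    show "U (x_op Q (a e) \<psi>) = pauli_X R e (U \<psi>)"
    proof
      fix t
      show "U (x_op Q (a e) \<psi>) t = pauli_X R e (U \<psi>) t"
      proof (cases "t \<subseteq> R")
        case True
        then have "rep (if e \<in> t then t - {e} else insert e t) = sym_diff (rep t) (a e)"
          unfolding rep_def using finite_subset[OF True finite_R] by (rule_tac ssum_flip)
        moreover have "(if e \<in> t then t - {e} else insert e t) \<subseteq> R" using True e by auto
        ultimately show ?thesis using True rep_subset[OF True]
          by (simp only: U_def pauli_X_def pauli_op_def) simp
      qed (simp add: U_def pauli_X_def)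
    qed
    show "U (z_op Q (b e) \<psi>) = pauli_Z R e (U \<psi>)"
      using e rep_subset by (auto simp: U_def pauli_Z_def pauli_op_def fun_eq_iff chi_rep)
  qed
qed

text \<open>The indicator functions of the cosets form a basis. Their values at representatives are
  Kronecker deltas, which gives the coefficients for spanning as well as independence.\<close>

theorem state_dim_code: "state_dim code = 2 ^ card R"
proof -
  define \<beta> where "\<beta> t = coset_state (\<lambda>u. if u = t then 1 else 0)" for t
  have \<beta>_rep: "\<beta> t (rep u) = (if u = t then 1 else 0)" if "u \<subseteq> R" for t u
    using that by (simp add: \<beta>_def coset_state_def rep_in_V syn_rep)
  have inj: "inj_on \<beta> (Pow R)"
    by (rule inj_onI) (metis \<beta>_rep PowD zero_neq_one)
  show ?thesis
  proof (rule states.dim_unique)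
    show "\<beta> ` Pow R \<subseteq> code" using coset_state_in_code by (auto simp: \<beta>_def)
    show "code \<subseteq> states.span (\<beta> ` Pow R)"
    proof
      fix \<psi> assume C: "\<psi> \<in> code"
      have "\<psi> = (\<Sum>t\<in>Pow R. scale_state (\<psi> (rep t)) (\<beta> t))"
      proof
        fix s
        show "\<psi> s = (\<Sum>t\<in>Pow R. scale_state (\<psi> (rep t)) (\<beta> t)) s"
        proof (cases "s \<in> V")
          case True
          have "(\<Sum>t\<in>Pow R. scale_state (\<psi> (rep t)) (\<beta> t)) s = (\<Sum>t\<in>Pow R. if syn s = t then \<psi> (rep t) else 0)"
            unfolding sum_apply using True
            by (intro sum.cong) (auto simp: scale_state_def \<beta>_def coset_state_def)
          also have "\<dots> = \<psi> s" using finite_R syn_subset True C by (simp add: code_eq_rep)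
          finally show ?thesis ..
        next
          case False
          then show ?thesis using C
            by (simp add: sum_apply scale_state_def \<beta>_def coset_state_def code_iff)
        qed
      qed
      also have "\<dots> \<in> states.span (\<beta> ` Pow R)"
        by (intro states.span_sum states.span_scale states.span_base imageI)
      finally show "\<psi> \<in> states.span (\<beta> ` Pow R)" .
    qed
    show "states.independent (\<beta> ` Pow R)"
    proof (rule states.independent_if_scalars_zero)
      fix f \<psi> assume eq: "(\<Sum>\<psi>\<in>\<beta> ` Pow R. scale_state (f \<psi>) \<psi>) = 0" and "\<psi> \<in> \<beta> ` Pow R"
      then obtain t where t: "t \<subseteq> R" "\<psi> = \<beta> t" by auto
      have "0 = (\<Sum>u\<in>Pow R. scale_state (f (\<beta> u)) (\<beta> u)) (rep t)"
        using eq inj by (simp add: sum.reindex)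
      also have "\<dots> = (\<Sum>u\<in>Pow R. if t = u then f (\<beta> u) else 0)"
        unfolding sum_apply using t by (intro sum.cong) (auto simp: scale_state_def \<beta>_rep)
      also have "\<dots> = f \<psi>" using t finite_R by simp
      finally show "f \<psi> = 0" ..
    qed (simp add: finite_R)
    show "card (\<beta> ` Pow R) = 2 ^ card R"
      using inj finite_R by (simp add: card_image card_Pow)
  qed
qed

end

section \<open>Geometry of the torus\<close>

lemma prod_cyclic_shift:
  fixes f :: "nat \<Rightarrow> 'a :: comm_monoid_mult"
  assumes "L > 0"
  shows "(\<Prod>x<L. f (Suc x mod L)) = (\<Prod>x<L. f x)"
proof -
  obtain n where L: "L = Suc n" using assms gr0_implies_Suc by blast
  have "(\<Prod>x<L. f (Suc x mod L)) = (\<Prod>x<n. f (Suc x)) * f 0"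
    by (simp add: L)
  also have "\<dots> = (\<Prod>x<L. f x)" by (simp only: L prod.lessThan_Suc_shift mult.commute)
  finally show ?thesis .
qed

lemma cyclic_const:
  assumes "\<And>x. x < L \<Longrightarrow> f (Suc x mod L) = f x" "x < L" "y < L"
  shows "f x = f y"
proof -
  have "f x = f 0" if "x < L" for x
    using that
  proof (induction x)
    case (Suc x)
    then show ?case using assms(1)[of x] by simp
  qed simp
  with assms(2,3) show ?thesis by metis
qed

lemma cyclic_pred_exists:
  fixes x :: nat
  assumes "x < L"
  obtains x' where "x' < L" "Suc x' mod L = x"
proof (cases x)
  case 0
  with assms that[of "L - 1"] show ?thesis by simp
next
  case (Suc x')
  with assms that[of x'] show ?thesis by simp
qed

lemma Suc_mod_inject: "x < L \<Longrightarrow> y < L \<Longrightarrow> Suc x mod L = Suc y mod L \<longleftrightarrow> x = y"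
  by (auto simp: mod_Suc split: if_splits)

section \<open>Sites and qubits of the torus\<close>

lemma finite_sites [simp]: "finite (sites L)"
  by (simp add: sites_def)

lemma card_sites: "card (sites L) = L\<^sup>2"
  by (simp add: sites_def power2_eq_square)

lemma mem_sites_iff: "(x, y) \<in> sites L \<longleftrightarrow> x < L \<and> y < L"
  by (simp add: sites_def)

lemma east_north_in_sites [simp]:
  "p \<in> sites L \<Longrightarrow> east L p \<in> sites L" "p \<in> sites L \<Longrightarrow> north L p \<in> sites L"
  by (auto simp: sites_def east_def north_def)

lemma north_east [simp]: "north L (east L p) = east L (north L p)"
  by (simp add: east_def north_def)

lemma fst_snd_east_north [simp]: 
  "snd (east L p) = snd p" "fst (north L p) = fst p" "fst (east L (north L p)) = fst (east L p)"
  by (simp_all add: east_def north_def)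

lemma east_north_inject [simp]:
  "p \<in> sites L \<Longrightarrow> q \<in> sites L \<Longrightarrow> east L p = east L q \<longleftrightarrow> p = q"
  "p \<in> sites L \<Longrightarrow> q \<in> sites L \<Longrightarrow> north L p = north L q \<longleftrightarrow> p = q"
  by (auto simp: sites_def east_def north_def Suc_mod_inject)

lemma east_exists:
  assumes "p \<in> sites L"
  obtains q where "q \<in> sites L" "p = east L q"
proof -
  obtain x y where p: "p = (x, y)" "x < L" "y < L" using assms by (cases p) (auto simp: sites_def)
  obtain x' where "x' < L" "Suc x' mod L = x" using cyclic_pred_exists[OF p(2)] .
  with p that[of "(x', y)"] show ?thesis by (simp add: east_def sites_def)
qed

lemma north_exists:
  assumes "p \<in> sites L"
  obtains q where "q \<in> sites L" "p = north L q"
proof -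
  obtain x y where p: "p = (x, y)" "x < L" "y < L" using assms by (cases p) (auto simp: sites_def)
  obtain y' where "y' < L" "Suc y' mod L = y" using cyclic_pred_exists[OF p(3)] .
  with p that[of "(x, y')"] show ?thesis by (simp add: north_def sites_def)
qed

lemma mem_qubits_iff [simp]:
  "Vertex p \<in> qubits L \<longleftrightarrow> p \<in> sites L" "HEdge p \<in> qubits L \<longleftrightarrow> p \<in> sites L"
  "VEdge p \<in> qubits L \<longleftrightarrow> p \<in> sites L"
  by (auto simp: qubits_def)

lemma finite_qubits [simp]: "finite (qubits L)"
  by (simp add: qubits_def)

lemma card_qubits: "card (qubits L) = 3 * L\<^sup>2"
proof -
  have "card (Vertex ` sites L) = L\<^sup>2" "card (HEdge ` sites L) = L\<^sup>2" "card (VEdge ` sites L) = L\<^sup>2"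
    by (simp_all add: card_image inj_on_def card_sites)
  moreover have "card (qubits L) = card (Vertex ` sites L) + card (HEdge ` sites L) + card (VEdge ` sites L)"
    unfolding qubits_def by (subst card_Un_disjoint; auto)+
  ultimately show ?thesis by simp
qed

section \<open>Overlaps of triangles and stabilizers\<close>

definition tri :: "nat \<Rightarrow> corner \<Rightarrow> site \<Rightarrow> qubit set" where
  "tri L c p = (case triangle L c p of (u, f, g) \<Rightarrow> {u, f, g})"

abbreviation x_corner :: "corner \<Rightarrow> bool" where
  "x_corner c \<equiv> c = SW \<or> c = NE"

lemma tri_subset: "p \<in> sites L \<Longrightarrow> tri L c p \<subseteq> qubits L"
  by (cases c) (auto simp: tri_def)

lemma finite_tri [simp]: "finite (tri L c p)"
  by (cases c) (auto simp: tri_def)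

lemma chi_tri:
  "chi (tri L SW p) s = pm (Vertex p \<in> s) * (pm (HEdge p \<in> s) * pm (VEdge p \<in> s))"
  "chi (tri L SE p) s = pm (Vertex (east L p) \<in> s) * (pm (HEdge p \<in> s) * pm (VEdge (east L p) \<in> s))"
  "chi (tri L NW p) s = pm (Vertex (north L p) \<in> s) * (pm (HEdge (north L p) \<in> s) * pm (VEdge p \<in> s))"
  "chi (tri L NE p) s = pm (Vertex (east L (north L p)) \<in> s) *
     (pm (HEdge (north L p) \<in> s) * pm (VEdge (east L p) \<in> s))"
  by (simp_all add: tri_def chi_insert)

text \<open>For each pair of corners of opposite type the factor of the vertex cancels the factor of
  one edge, because both coincide under the same condition on \<open>p\<close> and \<open>q\<close>;
  the other edge is shared exactly if \<open>p = q\<close>.\<close>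

lemma chi_tri_tri:
  assumes "p \<in> sites L" "q \<in> sites L" "x_corner c" "\<not> x_corner d"
  shows "chi (tri L d q) (tri L c p) = pm (p = q)"
proof -
  have d: "d = SE \<or> d = NW" using assms(4) by (cases d) auto
  have eq: "east L q = east L (north L p) \<longleftrightarrow> q = north L p"
    "north L q = east L (north L p) \<longleftrightarrow> q = east L p"
    using assms east_north_inject(2)[of q L "east L p"] by simp_all
  show ?thesis using assms(3) d
    by (elim disjE) (simp_all only: chi_tri, auto simp: tri_def eq assms(1,2) eq_commute[of q p])
qed

lemma G_eq:
  assumes "p \<in> sites L"
  shows "G L c p = (if x_corner c then x_op (qubits L) (tri L c p) else z_op (qubits L) (tri L c p))"
proof -
  obtain u f g where T: "triangle L c p = (u, f, g)" by (cases "triangle L c p")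
  have d: "u \<noteq> f" "u \<noteq> g" "f \<noteq> g" using T by (cases c; auto)+
  have Q: "u \<in> qubits L" "f \<in> qubits L" "g \<in> qubits L"
    using T tri_subset[OF assms, of c] by (auto simp: tri_def)
  have s: "sym_diff {u} {f} = {u, f}" "sym_diff {u, f} {g} = {u, f, g}"
    using d by auto
  show ?thesis
    using Q by (simp add: G_def T tri_def pauli_X_eq_pauli_op pauli_Z_eq_pauli_op pauli_op_comp s)
qed

definition sx :: "nat \<Rightarrow> site \<Rightarrow> qubit set" where
  "sx L p = sym_diff (tri L SW p) (tri L NE p)"

definition sz :: "nat \<Rightarrow> site \<Rightarrow> qubit set" where
  "sz L p = sym_diff (tri L SE p) (tri L NW p)"

lemma sx_sz_subset: "p \<in> sites L \<Longrightarrow> sx L p \<subseteq> qubits L" "p \<in> sites L \<Longrightarrow> sz L p \<subseteq> qubits L"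
  using tri_subset[of p L SW] tri_subset[of p L NE] tri_subset[of p L SE] tri_subset[of p L NW]
  by (auto simp: sx_def sz_def)

lemma finite_sx_sz [simp]: "finite (sx L p)" "finite (sz L p)"
  by (simp_all add: sx_def sz_def)

lemma SX_eq: "p \<in> sites L \<Longrightarrow> SX L p = x_op (qubits L) (sx L p)"
  by (simp add: SX_def G_eq pauli_op_comp tri_subset sx_def)

lemma SZ_eq: "p \<in> sites L \<Longrightarrow> SZ L p = z_op (qubits L) (sz L p)"
  by (simp add: SZ_def G_eq pauli_op_comp tri_subset sz_def)

lemma chi_sx_left: "chi (sx L p) s = chi (tri L SW p) s * chi (tri L NE p) s"
  by (simp only: sx_def chi_sym_diff_left finite_tri)

lemma chi_sz_left: "chi (sz L p) s = chi (tri L SE p) s * chi (tri L NW p) s"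
  by (simp only: sz_def chi_sym_diff_left finite_tri)

lemma chi_sz_tri: "p \<in> sites L \<Longrightarrow> q \<in> sites L \<Longrightarrow> x_corner c \<Longrightarrow> chi (sz L q) (tri L c p) = 1"
  by (simp add: chi_sz_left chi_tri_tri)

lemma chi_tri_sx: "p \<in> sites L \<Longrightarrow> q \<in> sites L \<Longrightarrow> \<not> x_corner d \<Longrightarrow> chi (tri L d q) (sx L p) = 1"
  by (simp only: sx_def chi_sym_diff_right) (simp add: chi_tri_tri)

lemma chi_sz_sx: "p \<in> sites L \<Longrightarrow> q \<in> sites L \<Longrightarrow> chi (sz L q) (sx L p) = 1"
  by (simp add: chi_sz_left chi_tri_sx)

section \<open>Horizontal and vertical lines\<close>

lemma hline_vline_subset: "y < L \<Longrightarrow> hline L y \<subseteq> qubits L" "x < L \<Longrightarrow> vline L x \<subseteq> qubits L"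
  by (auto simp: hline_def vline_def mem_sites_iff)

lemma mem_hline_iff [simp]:
  assumes "p \<in> sites L"
  shows "Vertex p \<in> hline L y \<longleftrightarrow> snd p = y" "HEdge p \<in> hline L y \<longleftrightarrow> snd p = y" "VEdge p \<notin> hline L y"
  using assms by (cases p; auto simp: hline_def mem_sites_iff)+

lemma mem_vline_iff [simp]:
  assumes "p \<in> sites L"
  shows "Vertex p \<in> vline L x \<longleftrightarrow> fst p = x" "VEdge p \<in> vline L x \<longleftrightarrow> fst p = x" "HEdge p \<notin> vline L x"
  using assms by (cases p; auto simp: vline_def mem_sites_iff)+

lemma chi_hline: "chi (hline L y) s = (\<Prod>x<L. pm (Vertex (x, y) \<in> s) * pm (HEdge (x, y) \<in> s))"
proof -
  have "chi (hline L y) s = (\<Prod>x<L. \<Prod>j\<in>{Vertex (x, y), HEdge (x, y)}. pm (j \<in> s))"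
    unfolding hline_def chi_def by (intro prod.UNION_disjoint) auto
  then show ?thesis by simp
qed

lemma chi_vline: "chi (vline L x) s = (\<Prod>y<L. pm (Vertex (x, y) \<in> s) * pm (VEdge (x, y) \<in> s))"
proof -
  have "chi (vline L x) s = (\<Prod>y<L. \<Prod>j\<in>{Vertex (x, y), VEdge (x, y)}. pm (j \<in> s))"
    unfolding vline_def chi_def by (intro prod.UNION_disjoint) auto
  then show ?thesis by simp
qed

lemma finite_hline_vline [simp]: "finite (hline L y)" "finite (vline L x)"
  by (simp_all add: hline_def vline_def)

text \<open>The vertex and the horizontal edge of a triangle have the same height and its vertical
  edge is on no horizontal line, so two equal signs cancel.\<close>

lemma chi_tri_hline: "p \<in> sites L \<Longrightarrow> chi (tri L c p) (hline L y) = 1"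
  by (cases c) (simp_all only: chi_tri, simp_all)

lemma chi_tri_vline: "p \<in> sites L \<Longrightarrow> chi (tri L c p) (vline L x) = 1"
  by (cases c) (simp_all only: chi_tri, simp_all add: mult.left_commute)

lemma chi_hline_hline: "y < L \<Longrightarrow> chi (hline L y) (hline L y') = 1"
  by (simp add: chi_hline mem_sites_iff)

lemma chi_vline_vline: "x < L \<Longrightarrow> chi (vline L x) (vline L x') = 1"
  by (simp add: chi_vline mem_sites_iff)

text \<open>A horizontal and a vertical line cross in one vertex and share no edge; this single
  qubit is the source of anticommutation.\<close>

lemma chi_vline_hline: "x < L \<Longrightarrow> y < L \<Longrightarrow> chi (vline L x) (hline L y) = - 1"
  by (simp add: chi_vline mem_sites_iff prod_pm_delta)

lemma chi_hline_vline: "x < L \<Longrightarrow> y < L \<Longrightarrow> chi (hline L y) (vline L x) = - 1"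
  by (simp add: chi_hline mem_sites_iff prod_pm_delta)


text \<open>Translating a line by one step multiplies it with the stabilizers of the strip in between.\<close>

lemma chi_line_translate:
  fixes s :: "qubit set"
  assumes f: "(\<forall>p\<in>sites L. chi (sx L p) s = 1) \<or> (\<forall>p\<in>sites L. chi (sz L p) s = 1)"
  shows "y < L \<Longrightarrow> chi (hline L (Suc y mod L)) s = chi (hline L y) s"
    and "x < L \<Longrightarrow> chi (vline L (Suc x mod L)) s = chi (vline L x) s"
proof -
  define v h w where "v x y = pm (Vertex (x, y) \<in> s)" and "h x y = pm (HEdge (x, y) \<in> s)"
    and "w x y = pm (VEdge (x, y) \<in> s)" for x y
  \<comment> \<open>In coordinates the two types of stabilizers differ only in which diagonal of the
    plaquette carries the vertices; the strip argument below is blind to that.\<close>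
  have f': "(\<forall>x<L. \<forall>y<L. v x y * h x y * w x y *
        v (Suc x mod L) (Suc y mod L) * h x (Suc y mod L) * w (Suc x mod L) y = 1) \<or>
      (\<forall>x<L. \<forall>y<L. v (Suc x mod L) y * h x y * w (Suc x mod L) y *
        v x (Suc y mod L) * h x (Suc y mod L) * w x y = 1)"
    using f
  proof (elim disjE)
    assume *: "\<forall>p\<in>sites L. chi (sx L p) s = 1"
    show ?thesis
    proof (intro disjI1 allI impI)
      fix x y assume "x < L" "y < L"
      with *[rule_format, of "(x, y)"] show "v x y * h x y * w x y *
        v (Suc x mod L) (Suc y mod L) * h x (Suc y mod L) * w (Suc x mod L) y = 1"
        by (simp add: chi_sx_left chi_tri mem_sites_iff east_def north_def v_def h_def w_def mult_ac)
    qed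
  next
    assume *: "\<forall>p\<in>sites L. chi (sz L p) s = 1"
    show ?thesis
    proof (intro disjI2 allI impI)
      fix x y assume "x < L" "y < L"
      with *[rule_format, of "(x, y)"] show "v (Suc x mod L) y * h x y * w (Suc x mod L) y *
        v x (Suc y mod L) * h x (Suc y mod L) * w x y = 1"
        by (simp add: chi_sz_left chi_tri mem_sites_iff east_def north_def v_def h_def w_def mult_ac)
    qed
  qed
  have *: "A = B" if "A * B = 1" "A * A = 1" for A B :: complex
    using that by (metis mult.left_commute mult.right_neutral)
  {
    fix y assume "y < L"
    then have "L > 0" by simp
    let ?y = "Suc y mod L"
    \<comment> \<open>The product over a strip with the factors realigned by a cyclic shift. Each
      vertical edge inside the strip occurs twice and cancels, which leaves the two bounding
      lines.\<close>
    define P where "P = (\<Prod>x<L. v x y * h x y * w x y * v x ?y * h x ?y * w x y)"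
    have "P = (\<Prod>x<L. v x y * h x y * w x y *
        v (Suc x mod L) (Suc y mod L) * h x (Suc y mod L) * w (Suc x mod L) y)"
      "P = (\<Prod>x<L. v (Suc x mod L) y * h x y * w (Suc x mod L) y *
        v x (Suc y mod L) * h x (Suc y mod L) * w x y)"
      unfolding P_def prod.distrib
      using prod_cyclic_shift[OF \<open>L > 0\<close>, of "\<lambda>x. v x ?y"] prod_cyclic_shift[OF \<open>L > 0\<close>, of "\<lambda>x. v x y"]
        prod_cyclic_shift[OF \<open>L > 0\<close>, of "\<lambda>x. w x y"] by simp_all
    moreover have "(\<forall>x\<in>{..<L}. v x y * h x y * w x y *
        v (Suc x mod L) (Suc y mod L) * h x (Suc y mod L) * w (Suc x mod L) y = 1) \<or>
      (\<forall>x\<in>{..<L}. v (Suc x mod L) y * h x y * w (Suc x mod L) y *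
        v x (Suc y mod L) * h x (Suc y mod L) * w x y = 1)"
      using f' \<open>y < L\<close> by blast
    ultimately have "P = 1" by (metis (no_types, lifting) prod.neutral)
    have "chi (hline L ?y) s * chi (hline L y) s = P"
      unfolding chi_hline P_def prod.distrib[symmetric]
      by (intro prod.cong refl) (simp add: w_def h_def v_def mult_ac)
    with \<open>P = 1\<close> show "chi (hline L ?y) s = chi (hline L y) s" by (rule_tac *) simp_all
  }
  {
    fix x assume "x < L"
    then have "L > 0" by simp
    let ?x = "Suc x mod L"
    define P where "P = (\<Prod>y<L. v x y * w x y * h x y * v ?x y * w ?x y * h x y)"
    have "P = (\<Prod>y<L. v x y * h x y * w x y *
        v (Suc x mod L) (Suc y mod L) * h x (Suc y mod L) * w (Suc x mod L) y)"
      "P = (\<Prod>y<L. v (Suc x mod L) y * h x y * w (Suc x mod L) y *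
        v x (Suc y mod L) * h x (Suc y mod L) * w x y)"
      unfolding P_def prod.distrib
      using prod_cyclic_shift[OF \<open>L > 0\<close>, of "\<lambda>y. v ?x y"] prod_cyclic_shift[OF \<open>L > 0\<close>, of "\<lambda>y. v x y"]
        prod_cyclic_shift[OF \<open>L > 0\<close>, of "\<lambda>y. h x y"] by (simp_all add: mult_ac)
    moreover have "(\<forall>y\<in>{..<L}. v x y * h x y * w x y *
        v (Suc x mod L) (Suc y mod L) * h x (Suc y mod L) * w (Suc x mod L) y = 1) \<or>
      (\<forall>y\<in>{..<L}. v (Suc x mod L) y * h x y * w (Suc x mod L) y *
        v x (Suc y mod L) * h x (Suc y mod L) * w x y = 1)"
      using f' \<open>x < L\<close> by blast
    ultimately have "P = 1" by (metis (no_types, lifting) prod.neutral)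
    have "chi (vline L ?x) s * chi (vline L x) s = P"
      unfolding chi_vline P_def prod.distrib[symmetric]
      by (intro prod.cong refl) (simp add: w_def h_def v_def mult_ac)
    with \<open>P = 1\<close> show "chi (vline L ?x) s = chi (vline L x) s" by (rule_tac *) simp_all
  }
qed

fun qubit_site :: "qubit \<Rightarrow> site" where
  "qubit_site (Vertex p) = p"
| "qubit_site (HEdge p) = p"
| "qubit_site (VEdge p) = p"

lemma card_ge_if_odd_on_lines:
  assumes stab: "(\<forall>p\<in>sites L. chi (sx L p) s = 1) \<or> (\<forall>p\<in>sites L. chi (sz L p) s = 1)"
    and "finite s" "i < L" "chi (hline L i) s = - 1 \<or> chi (vline L i) s = - 1"
  shows "L \<le> card s"
proof -
  have hit: "\<exists>j\<in>s. j \<in> A" if "chi A s = - 1" for A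
  proof (rule ccontr)
    assume "\<not> (\<exists>j\<in>s. j \<in> A)"
    then have "chi A s = (\<Prod>j\<in>A. 1)" unfolding chi_def by (intro prod.cong) auto
    with that show False by simp
  qed
  \<comment> \<open>Disjointness of parallel lines is used through a coordinate: if \<open>s\<close>
    meets every line, that coordinate maps \<open>s\<close> onto all of
    \<open>{..<L}\<close>.\<close>
  obtain f :: "site \<Rightarrow> nat" where "{..<L} \<subseteq> (f \<circ> qubit_site) ` s"
    using assms(4)
  proof
    assume odd: "chi (hline L i) s = - 1"
    have "{..<L} \<subseteq> (snd \<circ> qubit_site) ` s"
    proof
      fix y assume y: "y \<in> {..<L}"
      have "chi (hline L y) s = - 1"
        using cyclic_const[of L "\<lambda>y. chi (hline L y) s", OF chi_line_translate(1)[OF stab], of y i] y odd assms(3)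
        by simp
      then obtain j where "j \<in> s" "j \<in> hline L y" using hit by blast
      then show "y \<in> (snd \<circ> qubit_site) ` s" by (force simp: hline_def)
    qed
    then show ?thesis by (rule that)
  next
    assume odd: "chi (vline L i) s = - 1"
    have "{..<L} \<subseteq> (fst \<circ> qubit_site) ` s"
    proof
      fix x assume x: "x \<in> {..<L}"
      have "chi (vline L x) s = - 1"
        using cyclic_const[of L "\<lambda>x. chi (vline L x) s", OF chi_line_translate(2)[OF stab], of x i] x odd assms(3)
        by simp
      then obtain j where "j \<in> s" "j \<in> vline L x" using hit by blast
      then show "x \<in> (fst \<circ> qubit_site) ` s" by (force simp: vline_def)
    qed
    then show ?thesis by (rule that)
  qed
  then have "card {..<L} \<le> card ((f \<circ> qubit_site) ` s)" using assms(2) by (intro card_mono) auto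
  also have "\<dots> \<le> card s" using assms(2) by (rule card_image_le)
  finally show ?thesis by simp
qed

section \<open>Dependencies and kernel of the stabilizers\<close>

text \<open>A discrete Poincare lemma on the dual lattice: \<open>h (north L q)\<close> is the step
  from plaquette \<open>q\<close> to its northern neighbour, \<open>w (east L q)\<close> the step to
  its eastern one. The products along a column and a row are the periods, and \<open>v\<close> is
  the diagonal step.\<close>

lemma torus_potential:
  fixes v h w :: "site \<Rightarrow> complex"
  assumes sq: "\<And>p. v p * v p = 1" "\<And>p. h p * h p = 1" "\<And>p. w p * w p = 1"
    and se: "\<And>q. q \<in> sites L \<Longrightarrow> v (east L q) * (h q * w (east L q)) = 1"
    and nw: "\<And>q. q \<in> sites L \<Longrightarrow> v (north L q) * (h (north L q) * w q) = 1"
    and col: "c < L" "(\<Prod>y<L. v (c, y) * w (c, y)) = 1"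
    and row: "r < L" "(\<Prod>x<L. v (x, r) * h (x, r)) = 1"
  obtains m :: "site \<Rightarrow> bool" where
    "\<And>q. q \<in> sites L \<Longrightarrow> h (north L q) = pm (m (north L q)) * pm (m q)"
    "\<And>q. q \<in> sites L \<Longrightarrow> w (east L q) = pm (m (east L q)) * pm (m q)"
    "\<And>q. q \<in> sites L \<Longrightarrow> v (east L (north L q)) = pm (m (east L (north L q))) * pm (m q)"
proof -
  have L: "L > 0" using col by simp
  have eqI: "a = b" if "a * b = 1" "a * a = 1" for a b :: complex
    using that by (metis mult.left_commute mult.right_neutral)
  have prod_sq: "(\<Prod>i\<in>I. f i) * (\<Prod>i\<in>I. f i) = 1" if "\<And>i. f i * f i = 1" for I and f :: "nat \<Rightarrow> complex"
    using that by (simp flip: prod.distrib)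
  have h_eq: "h q = v (east L q) * w (east L q)" if "q \<in> sites L" for q
    using se[OF that] sq by (rule_tac eqI) (simp_all add: mult_ac)
  have w_eq: "w q = v (north L q) * h (north L q)" if "q \<in> sites L" for q
    using nw[OF that] sq by (rule_tac eqI) (simp_all add: mult_ac)
  \<comment> \<open>Both sides contain the sign of the vertex \<open>east L (north L q)\<close>;
    eliminating it leaves the four edges there.\<close>
  have curl: "h (north L q) * h (east L (north L q)) = w (east L q) * w (east L (north L q))"
    if "q \<in> sites L" for q
    using h_eq[of "north L q"] w_eq[of "east L q"] that by simp
  have curl': "h (x, Suc y mod L) * h (Suc x mod L, Suc y mod L) = w (Suc x mod L, y) * w (Suc x mod L, Suc y mod L)"
    if "x < L" "y < L" for x y
    using curl[of "(x, y)"] that by (simp add: east_def north_def mem_sites_iff)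
  \<comment> \<open>Closedness equates the products over adjacent columns, as the vertical edges
    between them cancel around the cycle. On the column just west of \<open>c\<close> the SE
    triangles turn the product into that of the line \<open>c\<close>.\<close>
  have col1: "(\<Prod>y<L. h (x, y)) = 1" if "x < L" for x
  proof -
    define d where "d x = (\<Prod>y<L. h (x, y))" for x
    have "d (Suc x mod L) = d x" if "x < L" for x
    proof (rule eqI)
      have "d (Suc x mod L) * d x = (\<Prod>y<L. h (x, Suc y mod L) * h (Suc x mod L, Suc y mod L))"
        using prod_cyclic_shift[OF L, of "\<lambda>y. h (x, y)"] prod_cyclic_shift[OF L, of "\<lambda>y. h (Suc x mod L, y)"]
        by (simp add: d_def prod.distrib mult.commute)
      also have "\<dots> = (\<Prod>y<L. w (Suc x mod L, y) * w (Suc x mod L, Suc y mod L))"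
        using that by (intro prod.cong) (simp_all add: curl')
      also have "\<dots> = 1"
        using prod_cyclic_shift[OF L, of "\<lambda>y. w (Suc x mod L, y)"] sq by (simp add: prod.distrib prod_sq)
      finally show "d (Suc x mod L) * d x = 1" .
      show "d (Suc x mod L) * d (Suc x mod L) = 1" by (simp add: d_def prod_sq sq)
    qed
    note const = cyclic_const[of L d, OF this]
    obtain x' where x': "x' < L" "Suc x' mod L = c" using cyclic_pred_exists[OF col(1)] .
    have "d x' = (\<Prod>y<L. v (c, y) * w (c, y))"
      unfolding d_def using x' by (intro prod.cong) (auto simp: h_eq mem_sites_iff east_def)
    then show ?thesis using const[of x x'] that x' col by (simp add: d_def)
  qed
  have row1: "(\<Prod>x<L. w (x, y)) = 1" if "y < L" for y
  proof -
    define d where "d y = (\<Prod>x<L. w (x, y))" for y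
    have "d (Suc y mod L) = d y" if "y < L" for y
    proof (rule eqI)
      have "d (Suc y mod L) * d y = (\<Prod>x<L. w (Suc x mod L, y) * w (Suc x mod L, Suc y mod L))"
        using prod_cyclic_shift[OF L, of "\<lambda>x. w (x, y)"] prod_cyclic_shift[OF L, of "\<lambda>x. w (x, Suc y mod L)"]
        by (simp add: d_def prod.distrib mult.commute)
      also have "\<dots> = (\<Prod>x<L. h (x, Suc y mod L) * h (Suc x mod L, Suc y mod L))"
        using that by (intro prod.cong) (simp_all add: curl')
      also have "\<dots> = 1"
        using prod_cyclic_shift[OF L, of "\<lambda>x. h (x, Suc y mod L)"] sq by (simp add: prod.distrib prod_sq)
      finally show "d (Suc y mod L) * d y = 1" .
      show "d (Suc y mod L) * d (Suc y mod L) = 1" by (simp add: d_def prod_sq sq)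
    qed
    note const = cyclic_const[of L d, OF this]
    obtain y' where y': "y' < L" "Suc y' mod L = r" using cyclic_pred_exists[OF row(1)] .
    have "d y' = (\<Prod>x<L. v (x, r) * h (x, r))"
      unfolding d_def using y' by (intro prod.cong) (auto simp: w_eq mem_sites_iff north_def)
    then show ?thesis using const[of y y'] that y' row by (simp add: d_def)
  qed
  \<comment> \<open>The form is integrated from the origin, first east along row 0, then north in
    column \<open>x\<close>; as \<open>x\<close> and \<open>y\<close> stay below \<open>L\<close>,
    the path never wraps around.\<close>
  define \<mu> where "\<mu> x y = (\<Prod>i<x. w (Suc i, 0)) * (\<Prod>j<y. h (x, Suc j))" for x y
  have \<mu>_sq: "\<mu> x y * \<mu> x y = 1" for x y
  proof -
    have "\<mu> x y * \<mu> x y = ((\<Prod>i<x. w (Suc i, 0)) * (\<Prod>i<x. w (Suc i, 0))) *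
        ((\<Prod>j<y. h (x, Suc j)) * (\<Prod>j<y. h (x, Suc j)))"
      unfolding \<mu>_def by (simp only: mult_ac)
    then show ?thesis using prod_sq[of "\<lambda>i. w (Suc i, 0)"] prod_sq[of "\<lambda>j. h (x, Suc j)"] sq by simp
  qed
  have \<mu>_sq': "\<mu> x y * (\<mu> x y * z) = z" for x y z
    using \<mu>_sq by (simp flip: mult.assoc)
  obtain n where n: "L = Suc n" using L gr0_implies_Suc by blast
  have north_step: "h (x, Suc y mod L) = \<mu> x (Suc y mod L) * \<mu> x y" if "x < L" "y < L" for x y
  proof (cases "Suc y < L")
    case True
    have "\<mu> x (Suc y) = \<mu> x y * h (x, Suc y)" by (simp add: \<mu>_def mult.assoc)
    then show ?thesis using True \<mu>_sq' by (simp add: mult_ac)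
  next
    case False
    then have y: "y = n" using that n by simp
    \<comment> \<open>Only the step from the last row back to row 0 needs the trivial
      period.\<close>
    have "h (x, 0) * (\<Prod>j<n. h (x, Suc j)) = 1"
      using col1[OF that(1)] unfolding n prod.lessThan_Suc_shift .
    then have "(\<Prod>j<n. h (x, Suc j)) = h (x, 0)"
      using sq by (rule_tac eqI) (simp_all add: prod_sq mult.commute)
    then have "\<mu> x n = \<mu> x 0 * h (x, 0)" by (simp add: \<mu>_def)
    then show ?thesis using y n \<mu>_sq' by (simp add: mult_ac)
  qed
  have east_step: "w (Suc x mod L, y) = \<mu> (Suc x mod L) y * \<mu> x y" if "x < L" "y < L" for x y
    using that(2)
  proof (induction y)
    case 0
    show ?case
    proof (cases "Suc x < L")
      case True
      have "\<mu> (Suc x) 0 = \<mu> x 0 * w (Suc x, 0)" by (simp add: \<mu>_def)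
      then show ?thesis using True \<mu>_sq' by (simp add: mult_ac)
    next
      case False
      then have x: "x = n" using that n by simp
      have "w (0, 0) * (\<Prod>j<n. w (Suc j, 0)) = 1"
        using row1[OF L] unfolding n prod.lessThan_Suc_shift .
      then have "(\<Prod>j<n. w (Suc j, 0)) = w (0, 0)"
        using sq by (rule_tac eqI) (simp_all add: prod_sq mult.commute)
      then have "\<mu> n 0 = \<mu> 0 0 * w (0, 0)" by (simp add: \<mu>_def)
      then show ?thesis using x n \<mu>_sq' by (simp add: mult_ac)
    qed
  next
    case (Suc y)
    let ?x = "Suc x mod L"
    have IH: "w (?x, y) = \<mu> ?x y * \<mu> x y" using Suc by simp
    have S: "?x < L" "Suc y mod L = Suc y" using L Suc.prems by simp_all
    \<comment> \<open>Closedness carries the eastward step up by one row, starting from row 0, where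
      the path of integration contains it.\<close>
    have "w (?x, y) * w (?x, Suc y) = h (x, Suc y) * h (?x, Suc y)"
      using curl'[of x y] that(1) Suc.prems S by simp
    also have "\<dots> = (\<mu> x (Suc y) * \<mu> x y) * (\<mu> ?x (Suc y) * \<mu> ?x y)"
      using north_step[OF that(1), of y] north_step[OF S(1), of y] Suc.prems S(2) by simp
    also have "\<dots> = w (?x, y) * (\<mu> ?x (Suc y) * \<mu> x (Suc y))"
      by (simp add: IH mult_ac)
    finally have "w (?x, y) * w (?x, Suc y) = w (?x, y) * (\<mu> ?x (Suc y) * \<mu> x (Suc y))" .
    moreover have "w (?x, y) \<noteq> 0" using sq(3)[of "(?x, y)"] by auto
    ultimately show ?case by simp
  qed
  define m where "m p = (\<mu> (fst p) (snd p) = - 1)" for p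
  have pm_m: "pm (m p) = \<mu> (fst p) (snd p)" for p
    using \<mu>_sq[of "fst p" "snd p"] square_eq_1_iff[of "\<mu> (fst p) (snd p)"] by (auto simp: m_def pm_def)
  have 1: "h (north L q) = pm (m (north L q)) * pm (m q)" if "q \<in> sites L" for q
    using north_step[of "fst q" "snd q"] that by (auto simp: pm_m north_def sites_def)
  have 2: "w (east L q) = pm (m (east L q)) * pm (m q)" if "q \<in> sites L" for q
    using east_step[of "fst q" "snd q"] that by (auto simp: pm_m east_def sites_def)
  show ?thesis
  proof (rule that[OF 1 2])
    fix q assume q: "q \<in> sites L"
    \<comment> \<open>The NW triangle of the eastern neighbour splits the diagonal step into one
      step east and one step north.\<close>
    have "v (east L (north L q)) = w (east L q) * h (east L (north L q))"
      using nw[of "east L q"] sq q by (rule_tac eqI) (simp_all add: mult_ac)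
    then show "v (east L (north L q)) = pm (m (east L (north L q))) * pm (m q)"
      using 2[of q] 1[of "east L q"] q by (simp add: mult_ac)
  qed
qed

section \<open>Signs of sums of stabilizer supports\<close>

lemma pm_mem_sx:
  "pm (Vertex p \<in> sx L i) = pm (p = i) * pm (p = east L (north L i))"
  "pm (HEdge p \<in> sx L i) = pm (p = i) * pm (p = north L i)"
  "pm (VEdge p \<in> sx L i) = pm (p = i) * pm (p = east L i)"
  unfolding sx_def pm_mem_sym_diff by (simp_all add: tri_def)

lemma pm_mem_sz:
  "pm (Vertex p \<in> sz L i) = pm (p = east L i) * pm (p = north L i)"
  "pm (HEdge p \<in> sz L i) = pm (p = i) * pm (p = north L i)"
  "pm (VEdge p \<in> sz L i) = pm (p = i) * pm (p = east L i)"
  unfolding sz_def pm_mem_sym_diff by (simp_all add: tri_def mult.commute)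

lemma prod_pm_inj:
  assumes "finite A" "A \<subseteq> S" "q \<in> S" "inj_on f S"
  shows "(\<Prod>i\<in>A. pm (f q = f i)) = pm (q \<in> A)"
proof -
  have "(\<Prod>i\<in>A. pm (f q = f i)) = (\<Prod>i\<in>A. pm (q = i))"
    using assms by (intro prod.cong) (auto simp: inj_on_def subset_iff)
  then show ?thesis using assms(1) by (simp add: prod_pm_delta)
qed

lemma inj_on_east_north:
  "inj_on (east L) (sites L)" "inj_on (north L) (sites L)" "inj_on (\<lambda>p. east L (north L p)) (sites L)"
  by (auto simp: inj_on_def)

text \<open>A qubit enters the X supports of two plaquettes: the neighbours across an edge, or the
  SW-NE diagonal pair at a vertex. Addressing the qubit as a shift of \<open>q\<close> names this
  pair without inverse shifts, in the form that \<open>torus_potential\<close> delivers.\<close>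

lemma pm_mem_ssum_sx:
  assumes "A \<subseteq> sites L" "q \<in> sites L"
  shows "pm (Vertex (east L (north L q)) \<in> ssum (sx L) A) = pm (east L (north L q) \<in> A) * pm (q \<in> A)"
    and "pm (HEdge (north L q) \<in> ssum (sx L) A) = pm (north L q \<in> A) * pm (q \<in> A)"
    and "pm (VEdge (east L q) \<in> ssum (sx L) A) = pm (east L q \<in> A) * pm (q \<in> A)"
  using finite_subset[OF assms(1) finite_sites] assms
    prod_pm_inj[OF _ assms inj_on_east_north(1)] prod_pm_inj[OF _ assms inj_on_east_north(2)]
    prod_pm_inj[OF _ assms inj_on_east_north(3)]
  by (simp_all only: pm_mem_ssum pm_mem_sx prod.distrib prod_pm_delta)

text \<open>Edges only: their signs suffice to force translation invariance of \<open>A\<close>. At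
  a vertex the two plaquettes lie on the other diagonal.\<close>

lemma pm_mem_ssum_sz:
  assumes "A \<subseteq> sites L" "q \<in> sites L"
  shows "pm (HEdge (north L q) \<in> ssum (sz L) A) = pm (north L q \<in> A) * pm (q \<in> A)"
    and "pm (VEdge (east L q) \<in> ssum (sz L) A) = pm (east L q \<in> A) * pm (q \<in> A)"
  using finite_subset[OF assms(1) finite_sites] assms
    prod_pm_inj[OF _ assms inj_on_east_north(1)] prod_pm_inj[OF _ assms inj_on_east_north(2)]
  by (simp_all only: pm_mem_ssum pm_mem_sz prod.distrib prod_pm_delta)

lemma qubit_cases:
  assumes "j \<in> qubits L"
  obtains q where "q \<in> sites L" "j = Vertex (east L (north L q))"
    | q where "q \<in> sites L" "j = HEdge (north L q)"
    | q where "q \<in> sites L" "j = VEdge (east L q)"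
proof (cases j)
  case (Vertex p)
  then have "p \<in> sites L" using assms by simp
  then obtain q where q: "q \<in> sites L" "p = east L q" by (rule east_exists)
  obtain q' where "q' \<in> sites L" "q = north L q'" using north_exists[OF q(1)] .
  with q Vertex that(1) show ?thesis by blast
next
  case (HEdge p)
  then have "p \<in> sites L" using assms by simp
  then show ?thesis using HEdge that(2) by (metis north_exists)
next
  case (VEdge p)
  then have "p \<in> sites L" using assms by simp
  then show ?thesis using VEdge that(3) by (metis east_exists)
qed

lemma toric_kernel:
  assumes "s \<subseteq> qubits L" "r < L" "c < L"
    and se: "\<And>p. p \<in> sites L \<Longrightarrow> chi (tri L SE p) s = 1"
    and nw: "\<And>p. p \<in> sites L \<Longrightarrow> chi (tri L NW p) s = 1"
    and lines: "chi (vline L c) s = 1" "chi (hline L r) s = 1"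
  shows "s \<in> ssum (sx L) ` Pow (sites L)"
proof -
  obtain m :: "site \<Rightarrow> bool" where m:
    "\<And>q. q \<in> sites L \<Longrightarrow> pm (HEdge (north L q) \<in> s) = pm (m (north L q)) * pm (m q)"
    "\<And>q. q \<in> sites L \<Longrightarrow> pm (VEdge (east L q) \<in> s) = pm (m (east L q)) * pm (m q)"
    "\<And>q. q \<in> sites L \<Longrightarrow> pm (Vertex (east L (north L q)) \<in> s) = pm (m (east L (north L q))) * pm (m q)"
    by (rule torus_potential[of "\<lambda>p. pm (Vertex p \<in> s)" "\<lambda>p. pm (HEdge p \<in> s)" "\<lambda>p. pm (VEdge p \<in> s)" L c r])
      (use se nw lines assms(2,3) in \<open>simp_all add: chi_tri chi_vline chi_hline\<close>)
  define M where "M = {p \<in> sites L. m p}"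
  have M: "M \<subseteq> sites L" by (auto simp: M_def)
  have "pm (j \<in> s) = pm (j \<in> ssum (sx L) M)" if "j \<in> qubits L" for j
    using that by (rule qubit_cases) (use pm_mem_ssum_sx[OF M] m in \<open>simp_all add: M_def\<close>)
  moreover have "ssum (sx L) M \<subseteq> qubits L" using M by (intro ssum_subset sx_sz_subset) auto
  ultimately have "s = ssum (sx L) M" using assms(1) by (auto simp del: pm_simps)
  with M show ?thesis by blast
qed

text \<open>Every qubit collects two equal signs from the plaquettes around it, so nothing survives
  in the sum over all of them.\<close>

lemma ssum_sites_empty:
  "ssum (sx L) (sites L) = {}" "ssum (sz L) (sites L) = {}"
proof -
  have x: "pm (j \<in> ssum (sx L) (sites L)) = 1" if "j \<in> qubits L" for j
    using that by (rule qubit_cases) (simp_all add: pm_mem_ssum_sx)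
  have z: "pm (j \<in> ssum (sz L) (sites L)) = 1" if j: "j \<in> qubits L" for j
    using j
  proof (rule qubit_cases)
    fix q assume q: "q \<in> sites L" and v: "j = Vertex (east L (north L q))"
    have "(\<Prod>i\<in>sites L. pm (east L (north L q) = east L i)) = - 1"
      using q by (subst prod_pm_inj[OF finite_sites order_refl _ inj_on_east_north(1)]) simp_all
    moreover have "(\<Prod>i\<in>sites L. pm (east L (north L q) = north L i)) = - 1"
      using q unfolding north_east[symmetric]
      by (subst prod_pm_inj[OF finite_sites order_refl _ inj_on_east_north(2)]) simp_all
    ultimately show ?thesis by (simp add: v pm_mem_ssum pm_mem_sz prod.distrib)
  qed (simp_all add: pm_mem_ssum_sz)
  have "j \<notin> ssum f (sites L)"
    if "pm (j \<in> ssum f (sites L)) = 1" for j and f :: "site \<Rightarrow> qubit set"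
    using that by (auto simp: pm_def split: if_splits)
  moreover have "ssum (sx L) (sites L) \<subseteq> qubits L" "ssum (sz L) (sites L) \<subseteq> qubits L"
    by (intro ssum_subset sx_sz_subset; assumption)+
  ultimately show "ssum (sx L) (sites L) = {}" "ssum (sz L) (sites L) = {}"
    using x z by (meson equals0I subsetD)+
qed

lemma translation_invariant_sites:
  assumes "A \<subseteq> sites L" "\<And>q. q \<in> sites L \<Longrightarrow> north L q \<in> A \<longleftrightarrow> q \<in> A"
    "\<And>q. q \<in> sites L \<Longrightarrow> east L q \<in> A \<longleftrightarrow> q \<in> A"
  shows "A = {} \<or> A = sites L"
proof -
  have n: "(x, Suc y mod L) \<in> A \<longleftrightarrow> (x, y) \<in> A" if "x < L" "y < L" for x y
    using assms(2)[of "(x, y)"] that by (simp add: mem_sites_iff north_def)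
  have e: "(Suc x mod L, y) \<in> A \<longleftrightarrow> (x, y) \<in> A" if "x < L" "y < L" for x y
    using assms(3)[of "(x, y)"] that by (simp add: mem_sites_iff east_def)
  have const: "(x, y) \<in> A \<longleftrightarrow> (x', y') \<in> A" if "x < L" "y < L" "x' < L" "y' < L" for x y x' y'
    using cyclic_const[of L "\<lambda>y. (x, y) \<in> A", OF n, of y y']
      cyclic_const[of L "\<lambda>x. (x, y') \<in> A", OF e, of x x'] that by simp
  have "q \<in> A" if "p \<in> A" "q \<in> sites L" for p q
  proof -
    have "p \<in> sites L" using assms(1) that(1) by blast
    with that show ?thesis using const[of "fst p" "snd p" "fst q" "snd q"] by (simp add: sites_def mem_Times_iff)
  qed
  then show ?thesis using assms(1) by blast
qed

text \<open>An edge missing from the sum says that the plaquettes on its two sides are both in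
  \<open>A\<close> or both outside; north and east steps connect the whole torus.\<close>

lemma ssum_eq_emptyD:
  assumes "A \<subseteq> sites L" "ssum (sx L) A = {} \<or> ssum (sz L) A = {}"
  shows "A = {} \<or> A = sites L"
proof (rule translation_invariant_sites[OF assms(1)])
  fix q assume q: "q \<in> sites L"
  have *: "pm a * pm b = 1 \<longleftrightarrow> a = b" for a b by (auto simp: pm_def)
  from assms(2) have "pm (north L q \<in> A) * pm (q \<in> A) = 1"
    using pm_mem_ssum_sx(2)[OF assms(1) q] pm_mem_ssum_sz(1)[OF assms(1) q]
    by (elim disjE) (metis empty_iff pm_simps(2))+
  then show "north L q \<in> A \<longleftrightarrow> q \<in> A" by (simp only: *)
  from assms(2) have "pm (east L q \<in> A) * pm (q \<in> A) = 1"
    using pm_mem_ssum_sx(3)[OF assms(1) q] pm_mem_ssum_sz(2)[OF assms(1) q]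
    by (elim disjE) (metis empty_iff pm_simps(2))+
  then show "east L q \<in> A \<longleftrightarrow> q \<in> A" by (simp only: *)
qed

section \<open>The stabilizer group\<close>

lemma ssum_sym_diff:
  assumes "finite A" "finite B"
  shows "ssum f (sym_diff A B) = sym_diff (ssum f A) (ssum f B)"
proof -
  \<comment> \<open>Read as a pairing of the index set with the indices whose set contains
    \<open>j\<close>, the sum inherits additivity from \<open>chi\<close>.\<close>
  have chi: "pm (j \<in> ssum f I) = chi I {i. j \<in> f i}" if "finite I" for I j
    using that by (simp add: pm_mem_ssum chi_def)
  have "pm (j \<in> ssum f (sym_diff A B)) = pm (j \<in> sym_diff (ssum f A) (ssum f B))" for j
    unfolding pm_mem_sym_diff using assms by (subst (1 2 3) chi) (auto simp: chi_sym_diff_left)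
  then show ?thesis unfolding pm_eq_iff by blast
qed

text \<open>Normal form for stabilizer group elements. The coefficient 1 suffices because S^X and
  S^Z overlap evenly, so products never create a phase.\<close>

definition stab :: "nat \<Rightarrow> site set \<Rightarrow> site set \<Rightarrow> qubit qop" where
  "stab L A B = pauli_op (qubits L) 1 (ssum (sx L) A) (ssum (sz L) B)"

lemma ssum_sx_sz_subset:
  "A \<subseteq> sites L \<Longrightarrow> ssum (sx L) A \<subseteq> qubits L" "A \<subseteq> sites L \<Longrightarrow> ssum (sz L) A \<subseteq> qubits L"
  by (intro ssum_subset sx_sz_subset; blast)+

lemma chi_ssum_sz_ssum_sx:
  assumes "A \<subseteq> sites L" "B \<subseteq> sites L"
  shows "chi (ssum (sz L) B) (ssum (sx L) A) = 1"
proof -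
  have fin: "finite A" "finite B" using assms finite_subset finite_sites by blast+
  have "chi (sz L q) (ssum (sx L) A) = 1" if "q \<in> B" for q
    using subsetD[OF assms(1)] subsetD[OF assms(2) that] fin
    by (simp add: chi_ssum_right chi_sz_sx)
  then show ?thesis using fin by (simp add: chi_ssum_left)
qed

lemma finite_ssum_sz: "A \<subseteq> sites L \<Longrightarrow> finite (ssum (sz L) A)"
  using ssum_sx_sz_subset(2) finite_qubits finite_subset by metis

lemma stab_comp:
  assumes "A \<subseteq> sites L" "B \<subseteq> sites L" "A' \<subseteq> sites L" "B' \<subseteq> sites L"
  shows "stab L A B \<circ> stab L A' B' = stab L (sym_diff A A') (sym_diff B B')"
proof -
  have fin: "finite A" "finite B" "finite A'" "finite B'"
    using assms finite_subset finite_sites by blast+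
  show ?thesis
    unfolding stab_def ssum_sym_diff[OF fin(1,3)] ssum_sym_diff[OF fin(2,4)]
    using assms by (simp add: pauli_op_comp ssum_sx_sz_subset finite_ssum_sz chi_ssum_sz_ssum_sx)
qed

lemma ssum_single: "ssum f {i} = f i"
  using ssum_insert[of "{}" i f] by simp

lemma SX_eq_stab: "p \<in> sites L \<Longrightarrow> SX L p = stab L {p} {}"
  by (simp add: stab_def ssum_single SX_eq)

lemma SZ_eq_stab: "p \<in> sites L \<Longrightarrow> SZ L p = stab L {} {p}"
  by (simp add: stab_def ssum_single SZ_eq)

lemma id_op_eq_stab: "id_op (qubits L) = stab L {} {}"
  by (simp add: stab_def id_op_eq_pauli_op)

lemma stab_eqD:
  assumes "stab L A B = stab L A' B'"
    and "A \<subseteq> sites L" "B \<subseteq> sites L" "A' \<subseteq> sites L" "B' \<subseteq> sites L"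
  shows "A = A' \<or> sym_diff A A' = sites L" "B = B' \<or> sym_diff B B' = sites L"
proof -
  have fin: "finite A" "finite B" "finite A'" "finite B'"
    using assms finite_subset finite_sites by blast+
  have eq: "ssum (sx L) A = ssum (sx L) A'" "ssum (sz L) B = ssum (sz L) B'"
    using pauli_op_eqD(2,3)[OF assms(1)[unfolded stab_def] one_neq_zero] assms
    by (simp_all add: ssum_sx_sz_subset)
  have "ssum (sx L) (sym_diff A A') = {}" "ssum (sz L) (sym_diff B B') = {}"
    by (simp_all only: eq ssum_sym_diff[OF fin(1,3)] ssum_sym_diff[OF fin(2,4)] Diff_cancel Un_empty)
  moreover have "sym_diff A A' \<subseteq> sites L" "sym_diff B B' \<subseteq> sites L" using assms by blast+
  ultimately have "sym_diff A A' = {} \<or> sym_diff A A' = sites L" "sym_diff B B' = {} \<or> sym_diff B B' = sites L"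
    using ssum_eq_emptyD by blast+
  then show "A = A' \<or> sym_diff A A' = sites L" "B = B' \<or> sym_diff B B' = sites L" by blast+
qed

lemma op_prod_SX:
  assumes "A \<subseteq> sites L"
  shows "op_prod (qubits L) (SX L) A = stab L A {}"
  unfolding stab_def ssum_empty
  using finite_subset[OF assms finite_sites] subsetD[OF assms]
  by (intro op_prod_x_op) (simp_all add: SX_eq sx_sz_subset)

lemma op_prod_SZ:
  assumes "B \<subseteq> sites L"
  shows "op_prod (qubits L) (SZ L) B = stab L {} B"
  unfolding stab_def ssum_empty
  using finite_subset[OF assms finite_sites] subsetD[OF assms]
  by (intro op_prod_z_op) (simp_all add: SZ_eq sx_sz_subset)

lemma stabilizer_inv:
  assumes "p \<in> sites L"
  shows "inv\<^bsub>pauli_group (qubits L)\<^esub> (SX L p) = SX L p" "inv\<^bsub>pauli_group (qubits L)\<^esub> (SZ L p) = SZ L p"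
proof -
  have "SX L p \<in> carrier (pauli_group (qubits L))" "SZ L p \<in> carrier (pauli_group (qubits L))"
    using assms by (simp_all add: SX_eq SZ_eq x_op_z_op_in_pauli_group sx_sz_subset)
  moreover have "SX L p \<circ> SX L p = id_op (qubits L)" "SZ L p \<circ> SZ L p = id_op (qubits L)"
    using assms by (simp_all add: SX_eq_stab SZ_eq_stab stab_comp id_op_eq_stab)
  ultimately show "inv\<^bsub>pauli_group (qubits L)\<^esub> (SX L p) = SX L p" "inv\<^bsub>pauli_group (qubits L)\<^esub> (SZ L p) = SZ L p"
    using pauli_group_involution_inv finite_qubits by blast+
qed

lemma pauli_group_mult [simp]: "x \<otimes>\<^bsub>pauli_group Q\<^esub> y = x \<circ> y"
  and pauli_group_one [simp]: "\<one>\<^bsub>pauli_group Q\<^esub> = id_op Q"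
  by (simp_all add: pauli_group_def)

text \<open>Stated for generators from restricted label sets, so that it describes both the full
  group and the subgroup left after deleting one generator.\<close>

lemma generate_stab:
  assumes "S \<in> generate (pauli_group (qubits L)) H" "H \<subseteq> SX L ` A0 \<union> SZ L ` B0"
    "A0 \<subseteq> sites L" "B0 \<subseteq> sites L"
  shows "\<exists>A B. A \<subseteq> A0 \<and> B \<subseteq> B0 \<and> S = stab L A B"
proof -
  have gen: "\<exists>A B. A \<subseteq> A0 \<and> B \<subseteq> B0 \<and> h = stab L A B \<and> inv\<^bsub>pauli_group (qubits L)\<^esub> h = h" if "h \<in> H" for h
  proof -
    consider p where "p \<in> A0" "h = SX L p" | p where "p \<in> B0" "h = SZ L p"
      using assms(2) \<open>h \<in> H\<close> by blast
    then show ?thesis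
    proof cases
      case (1 p)
      then have p: "p \<in> sites L" using assms(3) by blast
      have "{p} \<subseteq> A0" using 1 by simp
      then show ?thesis using 1 stabilizer_inv(1)[OF p] SX_eq_stab[OF p] by (metis empty_subsetI)
    next
      case (2 p)
      then have p: "p \<in> sites L" using assms(4) by blast
      have "{p} \<subseteq> B0" using 2 by simp
      then show ?thesis using 2 stabilizer_inv(2)[OF p] SZ_eq_stab[OF p] by (metis empty_subsetI)
    qed
  qed
  show ?thesis
    using assms(1)
  proof (induction rule: generate.induct)
    case one
    then show ?case using id_op_eq_stab by auto
  next
    case (incl h)
    then show ?case using gen by blast
  next
    case (inv h)
    then show ?case using gen by metis
  next
    case (eng h1 h2)
    then obtain A B A' B' where AB: "A \<subseteq> A0" "B \<subseteq> B0" "h1 = stab L A B" "A' \<subseteq> A0" "B' \<subseteq> B0" "h2 = stab L A' B'"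
      by blast
    then have "h1 \<circ> h2 = stab L (sym_diff A A') (sym_diff B B')"
      using assms(3,4) stab_comp[of A L B A' B'] by (meson subset_trans)
    moreover have "sym_diff A A' \<subseteq> A0" "sym_diff B B' \<subseteq> B0" using AB by blast+
    ultimately show ?case unfolding pauli_group_mult by blast
  qed
qed

lemma stabilizer_group_stab:
  assumes "S \<in> stabilizer_group L"
  obtains A B where "A \<subseteq> sites L" "B \<subseteq> sites L" "S = stab L A B"
  using generate_stab[of S L "stabilizers L" "sites L" "sites L"] assms
  by (auto simp: stabilizer_group_def stabilizers_def)

section \<open>Independent generators\<close>

lemma generate_subset:
  assumes "\<And>h. h \<in> H \<Longrightarrow> h \<in> generate M K \<and> inv\<^bsub>M\<^esub> h \<in> generate M K"
  shows "generate M H \<subseteq> generate M K"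
proof
  fix S assume "S \<in> generate M H"
  then show "S \<in> generate M K"
    by (induction rule: generate.induct) (use assms generate.one generate.eng in fast)+
qed

lemma stabilizer_group_independent_gens:
  assumes "L \<ge> 2"
  shows "\<exists>Gs \<subseteq> stabilizers L. card Gs = 2 * (L\<^sup>2 - 1) \<and>
         independent_gens (pauli_group (qubits L)) Gs \<and>
         generate (pauli_group (qubits L)) Gs = stabilizer_group L"
proof -
  let ?P = "pauli_group (qubits L)"
  define p0 :: site where "p0 = (0, 0)"
  define I where "I = sites L - {p0}"
  have p0: "p0 \<in> sites L" using assms by (simp add: p0_def mem_sites_iff)
  have I: "I \<subseteq> sites L" "p0 \<notin> I" "finite I" by (auto simp: I_def)
  \<comment> \<open>Labels are unique up to complement in \<open>sites L\<close>. Labels inside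
    \<open>I\<close> all miss \<open>p0\<close>, which excludes the complement.\<close>
  have dist: "A = A' \<and> B = B'" if "stab L A B = stab L A' B'" "A \<subseteq> I" "B \<subseteq> I" "A' \<subseteq> I" "B' \<subseteq> I" for A A' B B'
  proof -
    have "p0 \<notin> sym_diff A A'" "p0 \<notin> sym_diff B B'" using that I by blast+
    then have "sym_diff A A' \<noteq> sites L" "sym_diff B B' \<noteq> sites L" using p0 by metis+
    then show ?thesis using stab_eqD[OF that(1)] that I by (meson subset_trans)
  qed
  define Gs where "Gs = SX L ` I \<union> SZ L ` I"
  have stab_I: "SX L p = stab L {p} {}" "SZ L p = stab L {} {p}" if "p \<in> I" for p
    using subsetD[OF I(1) that] by (simp_all add: SX_eq_stab SZ_eq_stab)
  have injX: "inj_on (SX L) I"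
    by (rule inj_onI) (use dist[of "{_}" "{}" "{_}" "{}"] stab_I in auto)
  have injZ: "inj_on (SZ L) I"
    by (rule inj_onI) (use dist[of "{}" "{_}" "{}" "{_}"] stab_I in auto)
  have disj: "SX L ` I \<inter> SZ L ` I = {}"
    using dist[of "{_}" "{}" "{}" "{_}"] stab_I by fastforce
  have "card I = L\<^sup>2 - 1" using p0 by (simp add: I_def card_sites)
  then have card: "card Gs = 2 * (L\<^sup>2 - 1)"
    unfolding Gs_def using I injX injZ disj by (simp add: card_Un_disjoint card_image)
  have sub: "Gs \<subseteq> stabilizers L" using I by (auto simp: Gs_def stabilizers_def)
  have indep: "g \<notin> generate ?P (Gs - {g})" if g: "g \<in> Gs" for g
  proof
    assume gen: "g \<in> generate ?P (Gs - {g})"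
    from g consider p where "p \<in> I" "g = SX L p" | p where "p \<in> I" "g = SZ L p"
      by (auto simp: Gs_def)
    then show False
    proof cases
      case (1 p)
      \<comment> \<open>Without \<open>g\<close> only labels avoiding \<open>p\<close> can be
        generated, whereas unique labelling demands \<open>{p}\<close>.\<close>
      have "Gs - {g} \<subseteq> SX L ` (I - {p}) \<union> SZ L ` I" using 1 by (auto simp: Gs_def)
      then obtain A B where AB: "A \<subseteq> I - {p}" "B \<subseteq> I" "g = stab L A B"
        using generate_stab[OF gen, of "I - {p}" I] I by blast
      then have "stab L {p} {} = stab L A B" using 1 stab_I by simp
      then have "{p} = A" using dist[of "{p}" "{}" A B] AB 1 by blast
      then show False using AB by blast
    next
      case (2 p)
      have "Gs - {g} \<subseteq> SX L ` I \<union> SZ L ` (I - {p})" using 2 by (auto simp: Gs_def)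
      then obtain A B where AB: "A \<subseteq> I" "B \<subseteq> I - {p}" "g = stab L A B"
        using generate_stab[OF gen, of I "I - {p}"] I by blast
      then have "stab L {} {p} = stab L A B" using 2 stab_I by simp
      then have "{p} = B" using dist[of "{}" "{p}" A B] AB 2 by blast
      then show False using AB by blast
    qed
  qed
  have prodX: "stab L A {} \<in> generate ?P Gs" if "A \<subseteq> I" for A
    using finite_subset[OF that I(3)] that
  proof (induction A rule: finite_induct)
    case empty
    then show ?case using generate.one[of ?P Gs] by (simp add: id_op_eq_stab)
  next
    case (insert p A)
    have "sym_diff {p} A = insert p A" using insert.hyps by blast
    moreover have "p \<in> sites L" "A \<subseteq> sites L" using insert.prems I by auto
    ultimately have eq: "stab L (insert p A) {} = SX L p \<circ> stab L A {}"
      using insert.prems stab_I(1)[of p] stab_comp[of "{p}" L "{}" A "{}"] by simp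
    have "SX L p \<in> generate ?P Gs" using insert.prems by (auto simp: Gs_def intro: generate.incl)
    moreover have "stab L A {} \<in> generate ?P Gs" using insert by simp
    ultimately show ?case unfolding eq by (rule generate.eng[of _ ?P, unfolded pauli_group_mult])
  qed
  have prodZ: "stab L {} A \<in> generate ?P Gs" if "A \<subseteq> I" for A
    using finite_subset[OF that I(3)] that
  proof (induction A rule: finite_induct)
    case empty
    then show ?case using generate.one[of ?P Gs] by (simp add: id_op_eq_stab)
  next
    case (insert p A)
    have "sym_diff {p} A = insert p A" using insert.hyps by blast
    moreover have "p \<in> sites L" "A \<subseteq> sites L" using insert.prems I by auto
    ultimately have eq: "stab L {} (insert p A) = SZ L p \<circ> stab L {} A"
      using insert.prems stab_I(2)[of p] stab_comp[of "{}" L "{p}" "{}" A] by simp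
    have "SZ L p \<in> generate ?P Gs" using insert.prems by (auto simp: Gs_def intro: generate.incl)
    moreover have "stab L {} A \<in> generate ?P Gs" using insert by simp
    ultimately show ?case unfolding eq by (rule generate.eng[of _ ?P, unfolded pauli_group_mult])
  qed
  \<comment> \<open>The dependency among all plaquettes returns the omitted generator as the product
    of the others of its type.\<close>
  have "ssum f {p0} = ssum f I" if "ssum f (sites L) = {}" for f :: "site \<Rightarrow> qubit set"
  proof -
    have "sites L = insert p0 I" using p0 by (auto simp: I_def)
    then have "sym_diff (f p0) (ssum f I) = {}" using that ssum_insert[OF I(3,2), of f] by simp
    then show ?thesis by (auto simp: ssum_single)
  qed
  then have origin: "stab L {p0} {} = stab L I {}" "stab L {} {p0} = stab L {} I"
    using ssum_sites_empty by (simp_all add: stab_def)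
  have gens: "SX L p \<in> generate ?P Gs \<and> SZ L p \<in> generate ?P Gs" if p: "p \<in> sites L" for p
  proof (cases "p = p0")
    case True
    then show ?thesis using prodX[of I] prodZ[of I] origin SX_eq_stab[OF p] SZ_eq_stab[OF p] by simp
  next
    case False
    then have "SX L p \<in> Gs" "SZ L p \<in> Gs" using p by (simp_all add: I_def Gs_def)
    then show ?thesis by (blast intro: generate.incl)
  qed
  have "h \<in> generate ?P Gs \<and> inv\<^bsub>?P\<^esub> h \<in> generate ?P Gs" if h: "h \<in> stabilizers L" for h
  proof -
    obtain p where p: "p \<in> sites L" "h = SX L p \<or> h = SZ L p" using h by (auto simp: stabilizers_def)
    have "inv\<^bsub>?P\<^esub> h = h" using p stabilizer_inv[OF p(1)] by metis
    then show ?thesis using p(2) gens[OF p(1)] by metis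
  qed
  then have "stabilizer_group L \<subseteq> generate ?P Gs"
    unfolding stabilizer_group_def by (rule generate_subset)
  moreover have "h \<in> generate ?P (stabilizers L) \<and> inv\<^bsub>?P\<^esub> h \<in> generate ?P (stabilizers L)" if h: "h \<in> Gs" for h
    using subsetD[OF sub h] by (simp add: generate.incl generate.inv)
  then have "generate ?P Gs \<subseteq> stabilizer_group L"
    unfolding stabilizer_group_def by (rule generate_subset)
  ultimately show ?thesis using card sub indep unfolding independent_gens_def by blast
qed

section \<open>Logical operators and distance\<close>

lemma encodes_cong:
  assumes "encodes Q C R X Z" "\<And>e. e \<in> R \<Longrightarrow> X' e = X e" "\<And>e. e \<in> R \<Longrightarrow> Z' e = Z e"
  shows "encodes Q C R X' Z'"
  using assms(1) unfolding encodes_def by (simp add: assms(2,3) cong: ball_cong)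

section \<open>Supports of the encoded Pauli operators\<close>

fun x_support :: "nat \<Rightarrow> nat \<Rightarrow> nat \<Rightarrow> encoded \<Rightarrow> qubit set" where
  "x_support L r c (Gauge p) = tri L SW p"
| "x_support L r c (Logical i) = (if i = 1 then hline L r else vline L c)"

fun z_support :: "nat \<Rightarrow> nat \<Rightarrow> nat \<Rightarrow> encoded \<Rightarrow> qubit set" where
  "z_support L r c (Gauge p) = tri L SE p"
| "z_support L r c (Logical i) = (if i = 1 then vline L c else hline L r)"

abbreviation encoded_qubits :: "nat \<Rightarrow> encoded set" where
  "encoded_qubits L \<equiv> gauge_qubits L \<union> logical_qubits"

lemma encoded_cases:
  assumes "e \<in> encoded_qubits L"
  obtains p where "p \<in> sites L" "e = Gauge p" | "e = Logical 1" | "e = Logical 2"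
  using assms by (auto simp: gauge_qubits_def logical_qubits_def)

lemma card_gauge_qubits: "card (gauge_qubits L) = L\<^sup>2"
  by (simp add: gauge_qubits_def card_image inj_on_def card_sites)

lemma card_logical_qubits: "card logical_qubits = 2"
  by (simp add: logical_qubits_def)

lemma finite_encoded_qubits: "finite (encoded_qubits L)"
  by (simp add: gauge_qubits_def logical_qubits_def)

lemma gauge_logical_disjoint: "gauge_qubits L \<inter> logical_qubits = {}"
  by (auto simp: gauge_qubits_def logical_qubits_def)

lemma card_encoded_qubits: "card (encoded_qubits L) = L\<^sup>2 + 2"
  using gauge_logical_disjoint[of L] card_gauge_qubits[of L] card_logical_qubits finite_encoded_qubits[of L]
  by (simp add: card_Un_disjoint)

lemma commute_stab_group:
  assumes "T \<subseteq> qubits L" "S \<in> stabilizer_group L"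
  shows "(\<And>p. p \<in> sites L \<Longrightarrow> chi (sz L p) T = 1) \<Longrightarrow> commute (x_op (qubits L) T) S"
    and "(\<And>p. p \<in> sites L \<Longrightarrow> chi (sx L p) T = 1) \<Longrightarrow> commute (z_op (qubits L) T) S"
proof -
  obtain A B where AB: "A \<subseteq> sites L" "B \<subseteq> sites L" "S = stab L A B"
    using stabilizer_group_stab[OF assms(2)] .
  have fin: "finite A" "finite B" using AB finite_subset finite_sites by blast+
  have finT: "finite T" "finite (ssum (sx L) A)"
    using assms(1) ssum_sx_sz_subset(1)[OF AB(1)] finite_subset finite_qubits by blast+
  {
    assume "\<And>p. p \<in> sites L \<Longrightarrow> chi (sz L p) T = 1"
    then have "chi (ssum (sz L) B) T = 1"
      using fin subsetD[OF AB(2)] by (simp add: chi_ssum_left)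
    then show "commute (x_op (qubits L) T) S"
      using assms(1) AB by (simp add: stab_def pauli_op_commute_iff ssum_sx_sz_subset)
  }
  {
    assume "\<And>p. p \<in> sites L \<Longrightarrow> chi (sx L p) T = 1"
    then have "chi (ssum (sx L) A) T = 1"
      using fin subsetD[OF AB(1)] by (simp add: chi_ssum_left)
    then have "chi T (ssum (sx L) A) = 1" using finT by (simp add: chi_commute)
    then show "commute (z_op (qubits L) T) S"
      using assms(1) AB by (simp add: stab_def pauli_op_commute_iff ssum_sx_sz_subset)
  }
qed

lemma chi_sx_tri:
  assumes "p \<in> sites L" "q \<in> sites L" "\<not> x_corner d"
  shows "chi (sx L p) (tri L d q) = 1"
  using chi_tri_sx[OF assms] by (simp add: chi_commute)

lemma stab_commute:
  assumes "A \<subseteq> sites L" "B \<subseteq> sites L" "A' \<subseteq> sites L" "B' \<subseteq> sites L"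
  shows "commute (stab L A B) (stab L A' B')"
  using assms by (simp add: stab_def pauli_op_commute_iff ssum_sx_sz_subset chi_ssum_sz_ssum_sx)

lemma stabilizer_in_group: "p \<in> sites L \<Longrightarrow> SX L p \<in> stabilizer_group L" "p \<in> sites L \<Longrightarrow> SZ L p \<in> stabilizer_group L"
  unfolding stabilizer_group_def by (auto intro!: generate.incl simp: stabilizers_def)

lemma G_commute_stabilizer_group:
  assumes "p \<in> sites L" "S \<in> stabilizer_group L"
  shows "commute (G L a p) S"
  using assms commute_stab_group[OF tri_subset[OF assms(1)] assms(2)]
  by (simp add: G_eq chi_sz_tri chi_sx_tri)

lemma G_commute:
  assumes "p \<in> sites L" "q \<in> sites L" "p \<noteq> q"
  shows "commute (G L a p) (G L b q)"
proof -
  have *: "tri L a p \<subseteq> qubits L" "tri L b q \<subseteq> qubits L" using assms by (simp_all add: tri_subset)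
  show ?thesis
  proof (cases "x_corner a"; cases "x_corner b")
    assume "x_corner a" "\<not> x_corner b"
    then show ?thesis using assms * by (simp only: G_eq) (simp add: pauli_op_commute_iff chi_tri_tri)
  next
    assume "\<not> x_corner a" "x_corner b"
    then show ?thesis using assms * by (simp only: G_eq) (simp add: pauli_op_commute_iff chi_tri_tri)
  next
    assume "x_corner a" "x_corner b"
    then show ?thesis using assms * by (simp only: G_eq) (simp add: pauli_op_commute_iff)
  next
    assume "\<not> x_corner a" "\<not> x_corner b"
    then show ?thesis using assms * by (simp only: G_eq) (simp add: pauli_op_commute_iff)
  qed
qed

lemma stabilizers_eq:
  "stabilizers L = (\<lambda>p. x_op (qubits L) (sx L p)) ` sites L \<union> (\<lambda>p. z_op (qubits L) (sz L p)) ` sites L"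
  unfolding stabilizers_def by (intro arg_cong2[where f = "(\<union>)"] image_cong) (simp_all add: SX_eq SZ_eq)

context
  fixes L r c :: nat
  assumes r: "r < L" and c: "c < L"
begin

lemma support_subset:
  assumes "e \<in> encoded_qubits L"
  shows "x_support L r c e \<subseteq> qubits L" "z_support L r c e \<subseteq> qubits L"
  by (rule encoded_cases[OF assms]; use tri_subset hline_vline_subset r c in simp)+

lemma logical_X_Z_eq:
  assumes "e \<in> encoded_qubits L"
  shows "logical_X L (hline L r) (vline L c) e = x_op (qubits L) (x_support L r c e)"
    "logical_Z L (hline L r) (vline L c) e = z_op (qubits L) (z_support L r c e)"
  by (rule encoded_cases[OF assms];
      use hline_vline_subset r c in \<open>simp add: G_eq op_prod_pauli_X op_prod_pauli_Z\<close>)+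

lemma chi_stabilizer_support:
  assumes "e \<in> encoded_qubits L" "p \<in> sites L"
  shows "chi (sz L p) (x_support L r c e) = 1" "chi (sx L p) (z_support L r c e) = 1"
proof -
  show "chi (sz L p) (x_support L r c e) = 1"
    by (rule encoded_cases[OF assms(1)])
      (use assms in \<open>simp_all add: chi_sz_left chi_tri_tri chi_tri_hline chi_tri_vline\<close>)
  show "chi (sx L p) (z_support L r c e) = 1"
  proof (rule encoded_cases[OF assms(1)])
    fix q assume "q \<in> sites L" "e = Gauge q"
    then show ?thesis using assms(2)
      by (simp add: chi_tri_sx chi_commute[of "sx L p" "tri L SE q"])
  qed (use assms in \<open>simp_all add: chi_sx_left chi_tri_hline chi_tri_vline\<close>)
qed

lemma chi_support_support:
  assumes "e \<in> encoded_qubits L" "f \<in> encoded_qubits L"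
  shows "chi (z_support L r c e) (x_support L r c f) = pm (e = f)"
proof -
  have t: "chi (hline L r) (tri L d p) = 1" "chi (vline L c) (tri L d p) = 1" if "p \<in> sites L" for p d
    using that by (simp_all add: chi_tri_hline chi_tri_vline chi_commute[of "hline L r"] chi_commute[of "vline L c"])
  show ?thesis
    by (rule encoded_cases[OF assms(1)]; rule encoded_cases[OF assms(2)])
      (use r c in \<open>simp_all add: chi_tri_tri t chi_tri_hline chi_tri_vline chi_hline_hline
        chi_vline_vline chi_vline_hline chi_hline_vline eq_commute\<close>)
qed

lemma toric_css: "css (qubits L) (sites L) (encoded_qubits L) (sx L) (sz L) (x_support L r c) (z_support L r c)"
proof
  fix s assume s: "s \<subseteq> qubits L" and Z: "\<And>p. p \<in> sites L \<Longrightarrow> chi (sz L p) s = 1"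
    and b: "\<And>e. e \<in> encoded_qubits L \<Longrightarrow> chi (z_support L r c e) s = 1"
  show "s \<in> ssum (sx L) ` Pow (sites L)"
  proof (rule toric_kernel[OF s r c])
    fix p assume p: "p \<in> sites L"
    show "chi (tri L SE p) s = 1" using b[of "Gauge p"] p by (simp add: gauge_qubits_def)
    \<comment> \<open>S^Z is the product of the SE and the NW triangle, so dividing out the gauge
      operator leaves NW.\<close>
    then show "chi (tri L NW p) s = 1" using Z[OF p] by (simp add: chi_sz_left)
  next
    show "chi (vline L c) s = 1" "chi (hline L r) s = 1"
      using b[of "Logical 1"] b[of "Logical 2"] by (simp_all add: logical_qubits_def)
  qed
next
  fix p e assume "p \<in> sites L" "e \<in> encoded_qubits L"
  then show "chi (z_support L r c e) (sx L p) = 1"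
    using chi_stabilizer_support(2)[of e p] support_subset(2)[of e]
    by (metis chi_commute finite_qubits finite_subset finite_sx_sz(1))
qed (use finite_encoded_qubits support_subset chi_stabilizer_support chi_support_support
      in \<open>simp_all add: sx_sz_subset chi_sz_sx\<close>)

lemma toric_state_dim: "state_dim (codespace (qubits L) (stabilizers L)) = 2 ^ (L\<^sup>2 + 2)"
  using css.state_dim_code[OF toric_css] by (simp only: stabilizers_eq card_encoded_qubits)

lemma toric_encodes:
  "encodes (qubits L) (codespace (qubits L) (stabilizers L)) (encoded_qubits L)
    (logical_X L (hline L r) (vline L c)) (logical_Z L (hline L r) (vline L c))"
  using css.encodes_code[OF toric_css] unfolding stabilizers_eq
  by (rule encodes_cong) (simp_all only: logical_X_Z_eq)

lemma logical_commute_G: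
  assumes "e \<in> logical_qubits" "p \<in> sites L"
  shows "commute (logical_X L (hline L r) (vline L c) e) (G L a p)"
    "commute (logical_Z L (hline L r) (vline L c) e) (G L a p)"
proof -
  have e: "e \<in> encoded_qubits L" using assms(1) by simp
  have "chi (tri L a p) (x_support L r c e) = 1" "chi (z_support L r c e) (tri L a p) = 1"
    using assms by (auto simp: logical_qubits_def chi_tri_hline chi_tri_vline
        chi_commute[of "hline L r"] chi_commute[of "vline L c"])
  then show "commute (logical_X L (hline L r) (vline L c) e) (G L a p)"
    "commute (logical_Z L (hline L r) (vline L c) e) (G L a p)"
    using assms(2) support_subset[OF e] tri_subset
    by (simp_all add: logical_X_Z_eq[OF e] G_eq pauli_op_commute_iff)
qed

lemma logical_commute:
  assumes e: "e \<in> encoded_qubits L" and f: "f \<in> encoded_qubits L"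
  shows "commute (logical_X L (hline L r) (vline L c) e) (logical_X L (hline L r) (vline L c) f)"
    "commute (logical_Z L (hline L r) (vline L c) e) (logical_Z L (hline L r) (vline L c) f)"
    "if e = f then anticommute (logical_X L (hline L r) (vline L c) e) (logical_Z L (hline L r) (vline L c) f)
     else commute (logical_X L (hline L r) (vline L c) e) (logical_Z L (hline L r) (vline L c) f)"
  using support_subset[OF e] support_subset[OF f] chi_support_support[OF f e]
  by (cases "e = f"; simp add: logical_X_Z_eq[OF e] logical_X_Z_eq[OF f] pauli_op_commute_iff)+

section \<open>Minimum distance\<close>

lemma weight_ge:
  assumes stab: "\<forall>S\<in>stabilizers L. commute (pauli_string (qubits L) P) S"
    and A: "A \<in> logical_X L (hline L r) (vline L c) ` logical_qubits \<union>
      logical_Z L (hline L r) (vline L c) ` logical_qubits"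
    and anti: "anticommute (pauli_string (qubits L) P) A"
  shows "L \<le> weight (qubits L) P"
proof -
  define X Z where "X = x_part (qubits L) P" and "Z = z_part (qubits L) P"
  have XZ: "X \<subseteq> qubits L" "Z \<subseteq> qubits L" by (auto simp: X_def Z_def x_part_def z_part_def)
  then have fin: "finite X" "finite Z" using finite_subset finite_qubits by blast+
  note str = pauli_string_eq_pauli_op[OF finite_qubits, of L P, folded X_def Z_def]
  note nz = y_phase_prod_nonzero[OF finite_qubits, of P L]
  have sx: "chi (sx L p) Z = 1" and sz: "chi (sz L p) X = 1" if p: "p \<in> sites L" for p
  proof -
    have "commute (pauli_string (qubits L) P) (SX L p)" "commute (pauli_string (qubits L) P) (SZ L p)"
      using stab p by (auto simp: stabilizers_def)
    then show "chi (sx L p) Z = 1" "chi (sz L p) X = 1"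
      using nz XZ fin p sx_sz_subset[OF p]
      by (simp_all add: str SX_eq SZ_eq pauli_op_commute_iff chi_commute)
  qed
  obtain e where e: "e \<in> logical_qubits"
    and "A = logical_X L (hline L r) (vline L c) e \<or> A = logical_Z L (hline L r) (vline L c) e"
    using A by blast
  \<comment> \<open>A logical X feels only the Z part of the error and a logical Z only its X part,
    so one of the parts alone already carries an odd line.\<close>
  then have "chi Z (x_support L r c e) = - 1 \<or> chi (z_support L r c e) X = - 1"
    using anti nz XZ support_subset[of e] 
    by (auto simp: str logical_X_Z_eq pauli_op_commute_iff minus_equation_iff[of _ 1] dest: sym)
  then have "(chi (hline L r) Z = - 1 \<or> chi (vline L c) Z = - 1) \<or> (chi (hline L r) X = - 1 \<or> chi (vline L c) X = - 1)"
    using e fin by (auto simp: logical_qubits_def chi_commute[of Z])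
  then have "L \<le> card Z \<or> L \<le> card X"
    using card_ge_if_odd_on_lines[of L Z] card_ge_if_odd_on_lines[of L X] fin sx sz r c
      chi_line_translate by blast
  moreover have "card Z \<le> card (X \<union> Z)" "card X \<le> card (X \<union> Z)"
    using fin by (auto intro: card_mono)
  ultimately show ?thesis unfolding weight_eq_card X_def[symmetric] Z_def[symmetric] by linarith
qed

text \<open>Multiplying the logical operator on the horizontal line by the triangles \<open>T\<^sup>S\<^sup>W\<close> based on that
  line leaves the \<open>L\<close> vertical edges above it.\<close>

lemma weight_L_error:
  obtains P where "\<forall>S\<in>stabilizers L. commute (pauli_string (qubits L) P) S"
    "anticommute (pauli_string (qubits L) P) (logical_Z L (hline L r) (vline L c) (Logical 1))"
    "weight (qubits L) P = L"
proof -
  define E where "E = (\<lambda>x. VEdge (x, r)) ` {..<L}"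
  define P where "P = (\<lambda>j. if j \<in> E then PX else PI)"
  have E: "E \<subseteq> qubits L" using r by (auto simp: E_def mem_sites_iff)
  have str: "pauli_string (qubits L) P = x_op (qubits L) E"
    unfolding P_def using E by (simp add: x_op_eq_pauli_string)
  have mem: "VEdge p \<in> E \<longleftrightarrow> snd p = r" if "p \<in> sites L" for p
    using that by (cases p) (auto simp: E_def mem_sites_iff)
  have mem': "Vertex p \<notin> E" "HEdge p \<notin> E" for p by (auto simp: E_def)
  \<comment> \<open>The two vertical edges of a plaquette have the same height, so their signs
    cancel.\<close>
  have "chi (sz L p) E = 1" if "p \<in> sites L" for p
    using that by (simp add: chi_sz_left chi_tri mem mem')
  then have "\<forall>S\<in>stabilizers L. commute (pauli_string (qubits L) P) S"
    using E by (auto simp: str stabilizers_eq pauli_op_commute_iff sx_sz_subset)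
  moreover have "chi (vline L c) E = - 1"
    using r c by (simp add: chi_vline mem mem' mem_sites_iff prod_pm_delta)
  then have "anticommute (pauli_string (qubits L) P) (logical_Z L (hline L r) (vline L c) (Logical 1))"
    using E c by (simp add: str op_prod_pauli_Z hline_vline_subset pauli_op_commute_iff)
  moreover have "{j \<in> qubits L. P j \<noteq> PI} = E" using E by (auto simp: P_def)
  then have "weight (qubits L) P = L"
    by (simp add: weight_def E_def card_image inj_on_def)
  ultimately show ?thesis by (rule that)
qed

lemma toric_min_distance:
  "min_distance (qubits L) (stabilizers L) (logical_X L (hline L r) (vline L c) ` logical_qubits \<union>
      logical_Z L (hline L r) (vline L c) ` logical_qubits) = L"
  unfolding min_distance_def
\<comment> \<open>The witness of weight \<open>L\<close> also shows that the set is nonempty, so its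
  \<open>Inf\<close> is not the default 0.\<close>
proof (rule cInf_eq_minimum)
  obtain P where "\<forall>S\<in>stabilizers L. commute (pauli_string (qubits L) P) S"
    "anticommute (pauli_string (qubits L) P) (logical_Z L (hline L r) (vline L c) (Logical 1))"
    "weight (qubits L) P = L" by (rule weight_L_error)
  then show "L \<in> {weight (qubits L) P |P. (\<forall>S\<in>stabilizers L. commute (pauli_string (qubits L) P) S) \<and>
      (\<exists>A\<in>logical_X L (hline L r) (vline L c) ` logical_qubits \<union>
        logical_Z L (hline L r) (vline L c) ` logical_qubits. anticommute (pauli_string (qubits L) P) A)}"
    by (intro CollectI exI[of _ P] conjI bexI[of _ "logical_Z L (hline L r) (vline L c) (Logical 1)"])
      (simp_all add: logical_qubits_def)
qed (use weight_ge in blast)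

end


section \<open>Dependencies as operator identities and the code parameters\<close>

lemma stabilizer_dependencies:
  assumes "A \<subseteq> sites L" "B \<subseteq> sites L"
    and "op_prod (qubits L) (SX L) A \<circ> op_prod (qubits L) (SZ L) B = id_op (qubits L)"
  shows "(A = {} \<or> A = sites L) \<and> (B = {} \<or> B = sites L)"
proof -
  have "stab L A B = stab L {} {}"
    using assms stab_comp[of A L "{}" "{}" B] by (simp add: op_prod_SX op_prod_SZ id_op_eq_stab)
  from stab_eqD[OF this assms(1,2)] show ?thesis by auto
qed

lemma op_prod_all_stabilizers:
  "op_prod (qubits L) (SX L) (sites L) = id_op (qubits L)"
  "op_prod (qubits L) (SZ L) (sites L) = id_op (qubits L)"
  by (simp_all add: op_prod_SX op_prod_SZ id_op_eq_stab stab_def ssum_sites_empty)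

theorem mainTheorem1:
  fixes L r c :: nat
    and \<Gamma> \<Lambda> :: "qubit set"
    and Q :: "qubit set"
    and X Z :: "encoded \<Rightarrow> qubit qop"
  assumes L: "L \<ge> 2"
    and Q: "Q = qubits L"
    and \<Gamma>: "r < L" "\<Gamma> = hline L r"
    and \<Lambda>: "c < L" "\<Lambda> = vline L c"
    and X: "X = logical_X L \<Gamma> \<Lambda>"
    and Z: "Z = logical_Z L \<Gamma> \<Lambda>"
  shows
    "\<comment> \<open>(i)\<close>
     ((\<forall>p\<in>plaquettes L. \<forall>q\<in>plaquettes L. \<forall>a b. p \<noteq> q \<longrightarrow> commute (G L a p) (G L b q)) \<and>
      (\<forall>p\<in>plaquettes L. \<forall>q\<in>plaquettes L. \<forall>a.
         commute (G L a p) (SX L q) \<and> commute (G L a p) (SZ L q)) \<and>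
      (\<forall>S\<in>stabilizer_group L. \<forall>T\<in>stabilizer_group L. commute S T)) \<and>
     \<comment> \<open>(ii)\<close>
     (op_prod Q (SX L) (plaquettes L) = id_op Q \<and>
      op_prod Q (SZ L) (plaquettes L) = id_op Q \<and>
      (\<forall>A B. A \<subseteq> plaquettes L \<longrightarrow> B \<subseteq> plaquettes L \<longrightarrow>
         op_prod Q (SX L) A \<circ> op_prod Q (SZ L) B = id_op Q \<longrightarrow>
         (A = {} \<or> A = plaquettes L) \<and> (B = {} \<or> B = plaquettes L)) \<and>
      (\<exists>Gs \<subseteq> stabilizers L. card Gs = 2 * (L^2 - 1) \<and>
         independent_gens (pauli_group Q) Gs \<and>
         generate (pauli_group Q) Gs = stabilizer_group L) \<and>
      state_dim (codespace Q (stabilizers L)) = 2 ^ (L^2 + 2)) \<and>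
     \<comment> \<open>(iii)\<close>
     (card (gauge_qubits L) = L^2 \<and> card logical_qubits = 2 \<and>
      encodes Q (codespace Q (stabilizers L)) (gauge_qubits L \<union> logical_qubits) X Z \<and>
      (\<forall>e\<in>gauge_qubits L \<union> logical_qubits.
         X e \<in> carrier (pauli_group Q) \<and> Z e \<in> carrier (pauli_group Q) \<and>
         (\<forall>S\<in>stabilizer_group L. commute (X e) S \<and> commute (Z e) S)) \<and>
      (\<forall>e\<in>gauge_qubits L \<union> logical_qubits. \<forall>f\<in>gauge_qubits L \<union> logical_qubits.
         commute (X e) (X f) \<and> commute (Z e) (Z f) \<and>
         (if e = f then anticommute (X e) (Z f) else commute (X e) (Z f))) \<and>
      (\<forall>e\<in>logical_qubits. \<forall>p\<in>plaquettes L. \<forall>a.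
         commute (X e) (G L a p) \<and> commute (Z e) (G L a p))) \<and>
     \<comment> \<open>(iv)\<close>
     min_distance Q (stabilizers L) (X ` logical_qubits \<union> Z ` logical_qubits) = L \<and>
     code_parameters Q (stabilizers L) (gauge_qubits L) logical_qubits X Z (3 * L^2) 2 L"
proof -
  have enc: "commute (X e) S" "commute (Z e) S" "X e \<in> carrier (pauli_group Q)" "Z e \<in> carrier (pauli_group Q)"
    if e: "e \<in> gauge_qubits L \<union> logical_qubits" and S: "S \<in> stabilizer_group L" for e S
    using commute_stab_group[OF support_subset(1)[OF \<Gamma>(1) \<Lambda>(1) e] S]
      commute_stab_group[OF support_subset(2)[OF \<Gamma>(1) \<Lambda>(1) e] S]
      chi_stabilizer_support[OF \<Gamma>(1) \<Lambda>(1) e] support_subset[OF \<Gamma>(1) \<Lambda>(1) e]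
    by (simp_all only: X Z Q \<Gamma>(2) \<Lambda>(2) logical_X_Z_eq[OF \<Gamma>(1) \<Lambda>(1) e] finite_qubits x_op_z_op_in_pauli_group)
  \<comment> \<open>Some group element has to instantiate \<open>S\<close> in \<open>enc\<close>
    before its two membership facts, which do not mention \<open>S\<close>, can be
    extracted.\<close>
  have "id_op Q \<in> stabilizer_group L"
    unfolding stabilizer_group_def using generate.one[of "pauli_group Q"] by (simp add: Q)
  note carr = enc(3,4)[OF _ this]
  have encodes: "encodes Q (codespace Q (stabilizers L)) (gauge_qubits L \<union> logical_qubits) X Z"
    using toric_encodes[OF \<Gamma>(1) \<Lambda>(1)] by (simp only: X Z Q \<Gamma>(2) \<Lambda>(2))
  have dist: "min_distance Q (stabilizers L) (X ` logical_qubits \<union> Z ` logical_qubits) = L"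
    using toric_min_distance[OF \<Gamma>(1) \<Lambda>(1)] by (simp only: X Z Q \<Gamma>(2) \<Lambda>(2))
  have i: "\<forall>p\<in>plaquettes L. \<forall>q\<in>plaquettes L. \<forall>a b. p \<noteq> q \<longrightarrow> commute (G L a p) (G L b q)"
    "\<forall>p\<in>plaquettes L. \<forall>q\<in>plaquettes L. \<forall>a. commute (G L a p) (SX L q) \<and> commute (G L a p) (SZ L q)"
    using G_commute G_commute_stabilizer_group stabilizer_in_group by blast+
  have abelian: "\<forall>S\<in>stabilizer_group L. \<forall>T\<in>stabilizer_group L. commute S T"
  proof (intro ballI)
    fix S T assume S: "S \<in> stabilizer_group L" and T: "T \<in> stabilizer_group L"
    obtain A B where "A \<subseteq> sites L" "B \<subseteq> sites L" "S = stab L A B" using stabilizer_group_stab[OF S] .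
    moreover obtain A' B' where "A' \<subseteq> sites L" "B' \<subseteq> sites L" "T = stab L A' B'"
      using stabilizer_group_stab[OF T] .
    ultimately show "commute S T" by (simp only: stab_commute)
  qed
  have ii: "op_prod Q (SX L) (plaquettes L) = id_op Q" "op_prod Q (SZ L) (plaquettes L) = id_op Q"
    "\<forall>A B. A \<subseteq> plaquettes L \<longrightarrow> B \<subseteq> plaquettes L \<longrightarrow>
         op_prod Q (SX L) A \<circ> op_prod Q (SZ L) B = id_op Q \<longrightarrow>
         (A = {} \<or> A = plaquettes L) \<and> (B = {} \<or> B = plaquettes L)"
    unfolding Q using op_prod_all_stabilizers stabilizer_dependencies by blast+
  have iii: "\<forall>e\<in>gauge_qubits L \<union> logical_qubits. \<forall>f\<in>gauge_qubits L \<union> logical_qubits.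
         commute (X e) (X f) \<and> commute (Z e) (Z f) \<and>
         (if e = f then anticommute (X e) (Z f) else commute (X e) (Z f))"
    "\<forall>e\<in>logical_qubits. \<forall>p\<in>plaquettes L. \<forall>a. commute (X e) (G L a p) \<and> commute (Z e) (G L a p)"
    unfolding X Z \<Gamma>(2) \<Lambda>(2)
    using logical_commute[OF \<Gamma>(1) \<Lambda>(1)] logical_commute_G[OF \<Gamma>(1) \<Lambda>(1)] by blast+
  have params: "code_parameters Q (stabilizers L) (gauge_qubits L) logical_qubits X Z (3 * L^2) 2 L"
    unfolding code_parameters_def
    using encodes dist card_qubits gauge_logical_disjoint card_logical_qubits Q by simp
  have carr': "\<forall>e\<in>gauge_qubits L \<union> logical_qubits.
         X e \<in> carrier (pauli_group Q) \<and> Z e \<in> carrier (pauli_group Q) \<and>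
         (\<forall>S\<in>stabilizer_group L. commute (X e) S \<and> commute (Z e) S)"
    using enc(1,2) carr by blast
  note gens = stabilizer_group_independent_gens[OF L, folded Q]
  note dim = toric_state_dim[OF \<Gamma>(1) \<Lambda>(1), folded Q]
  show ?thesis
    by (intro conjI)
      (fact i abelian ii gens dim card_gauge_qubits card_logical_qubits encodes carr' iii dist params)+
qed

end
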